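(* Let $(h,\nabla,\nabla^* )$ be a dually flat structure on a manifold $M$ of dimension $n$ and let $(g,J,\omega)$ be the Kähler structure on $TM$ associated to $(h,\nabla)$ via Dombrowski's construction. Let $f:TM\to\mathbb{R}$ be a smooth function. Given a coordinate system $x:U\to\mathbb{R}^n$ on $M$ that is affine with respect to $\nabla$, the function $f$ is Kähler on $\pi^{-1}(U)$ if and only if $$\begin{cases}\dfrac{\partial^2f}{\partial x_i\partial x_j}-\dfrac{\partial^2f}{\partial\dot x_i\partial\dot x_j}=2\displaystyle\sum_{b=1}^n\big((\Gamma^h)^b_{ij}\circ\pi\big)\dfrac{\partial f}{\partial x_b},\\[2ex]\dfrac{\partial^2f}{\partial x_i\partial\dot x_j}+\dfrac{\partial^2f}{\partial x_j\partial\dot x_i}=2\displaystyle\sum_{b=1}^n\big((\Gamma^h)^b_{ij}\circ\pi\big)\dfrac{\partial f}{\partial\dot x_b},\end{cases}$$ for all $i,j=1,\dots,n$, where $(\Gamma^h)^b_{ij}$ are the Christoffel symbols of the Levi-Civita connection of $h$ in the coordinates $(x_1,\dots,x_n)$.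
   Context: Let $h$ be a Riemannian metric and $\nabla$ an affine connection on $M$. The dual connection $\nabla^*$ is the unique connection with $X(h(Y,Z))=h(\nabla_XY,Z)+h(Y,\nabla^*_XZ)$; $(h,\nabla,\nabla^* )$ is dually flat if both $\nabla$ and $\nabla^*$ have zero torsion and zero curvature. Coordinates are affine with respect to $\nabla$ if all Christoffel symbols of $\nabla$ vanish in them. $\pi:TM\to M$ is the projection and $(x_i,\dot x_i)$ are the coordinates on $\pi^{-1}(U)$ given by $x_i\circ\pi$ (still written $x_i$) and $\dot x_i=dx_i$. Dombrowski's construction: let $K:T(TM)\to TM$ be the connector of $\nabla$ (the unique map with $\nabla_XY=K\,Y_*X$). Identify $A\in T_{u}(TM)$, $u\in T_pM$, with $(u,v,w)=(u,\pi_*A,KA)$; then $g_u((u,v,w),(u,\bar v,\bar w))=h_p(v,\bar v)+h_p(w,\bar w)$, $J_u(u,v,w)=(u,-w,v)$, $\omega=g(J\cdot,\cdot)$. It is Kähler when the structure is dually flat. A smooth function $f$ on a Kähler manifold is Kähler if $\mathscr{L}_{X_f}g=0$, where $X_f$ is the Hamiltonian vector field ($\omega(X_f,\cdot)=df$). *)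

theory Defs
  imports "HOL-Analysis.Analysis" "HOL-Library.Function_Algebras"
begin

section \<open>Smooth maps between Euclidean spaces\<close>

text \<open>Both predicates are only meaningful for an open set \<open>S\<close>: the derivatives are taken in full
  neighbourhoods of the points of \<open>S\<close>.\<close>

primrec Ck_on :: "nat \<Rightarrow> 'a::euclidean_space set \<Rightarrow> ('a \<Rightarrow> 'b::real_normed_vector) \<Rightarrow> bool" where
  "Ck_on 0 S f \<longleftrightarrow> continuous_on S f"
| "Ck_on (Suc k) S f \<longleftrightarrow>
     (\<forall>x\<in>S. f differentiable (at x)) \<and> (\<forall>v. Ck_on k S (\<lambda>x. frechet_derivative f (at x) v))"

definition smooth_on :: "'a::euclidean_space set \<Rightarrow> ('a \<Rightarrow> 'b::real_normed_vector) \<Rightarrow> bool" where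
  "smooth_on S f \<longleftrightarrow> (\<forall>k. Ck_on k S f)"


section \<open>Smooth manifolds\<close>

text \<open>A chart is a pair \<open>(U, x)\<close> of a coordinate domain and a coordinate map; only the values of
  \<open>x\<close> on \<open>U\<close> matter. A manifold is given by its atlas: the underlying set is the union of the
  coordinate domains and the topology is the one determined by the charts.\<close>

type_synonym ('m, 'e) chart = "'m set \<times> ('m \<Rightarrow> 'e)"
type_synonym ('m, 'e) atlas = "('m, 'e) chart set"

definition points :: "('m, 'e) atlas \<Rightarrow> 'm set" where
  "points A = (\<Union>(U, x)\<in>A. U)"

definition is_chart :: "('m, 'e::euclidean_space) chart \<Rightarrow> bool" where
  "is_chart = (\<lambda>(U, x). inj_on x U \<and> open (x ` U))"

definition compatible :: "('m, 'e::euclidean_space) chart \<Rightarrow> ('m, 'e) chart \<Rightarrow> bool" where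
  "compatible = (\<lambda>(U, x) (V, y).
     open (x ` (U \<inter> V)) \<and> open (y ` (U \<inter> V)) \<and>
     smooth_on (x ` (U \<inter> V)) (y \<circ> inv_into U x) \<and> smooth_on (y ` (U \<inter> V)) (x \<circ> inv_into V y))"

definition manifold_open :: "('m, 'e::euclidean_space) atlas \<Rightarrow> 'm set \<Rightarrow> bool" where
  "manifold_open A W \<longleftrightarrow> W \<subseteq> points A \<and> (\<forall>(U, x)\<in>A. open (x ` (U \<inter> W)))"

definition smooth_manifold :: "('m, 'e::euclidean_space) atlas \<Rightarrow> bool" where
  "smooth_manifold A \<longleftrightarrow>
     (\<forall>c\<in>A. is_chart c) \<and>
     (\<forall>c\<in>A. \<forall>d\<in>A. compatible c d) \<and>
     (\<forall>c. is_chart c \<and> fst c \<subseteq> points A \<and> (\<forall>d\<in>A. compatible c d) \<longrightarrow> c \<in> A) \<and>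
     Hausdorff_space (topology (manifold_open A)) \<and>
     second_countable (topology (manifold_open A))"

text \<open>The family of sets used in \<open>smooth_manifold\<close> really is a topology.\<close>

lemma istopology_manifold_open:
  assumes charts: "\<forall>c\<in>A. is_chart c"
  shows "istopology (manifold_open A)"
  unfolding istopology_def
proof (intro conjI allI impI)
  fix S T assume S: "manifold_open A S" and T: "manifold_open A T"
  have "open (x ` (U \<inter> (S \<inter> T)))" if c: "(U, x) \<in> A" for U x
  proof -
    have "inj_on x U" using charts c by (auto simp: is_chart_def)
    then have "x ` (U \<inter> (S \<inter> T)) = x ` (U \<inter> S) \<inter> x ` (U \<inter> T)"
      by (auto simp: inj_on_def)
    moreover have "open (x ` (U \<inter> S))" "open (x ` (U \<inter> T))"
      using S T c by (auto simp: manifold_open_def)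
    ultimately show ?thesis by auto
  qed
  then show "manifold_open A (S \<inter> T)" using S T by (auto simp: manifold_open_def)
next
  fix \<K> assume K: "\<forall>K\<in>\<K>. manifold_open A K"
  have "open (x ` (U \<inter> \<Union>\<K>))" if c: "(U, x) \<in> A" for U x
  proof -
    have "x ` (U \<inter> \<Union>\<K>) = (\<Union>K\<in>\<K>. x ` (U \<inter> K))" by auto
    moreover have "open (x ` (U \<inter> K))" if "K \<in> \<K>" for K
      using K c that by (auto simp: manifold_open_def)
    ultimately show ?thesis by auto
  qed
  then show "manifold_open A (\<Union>\<K>)" using K by (auto simp: manifold_open_def)
qed

text \<open>The notions below do not need the atlas to be maximal; the atlas of the tangent bundle used
  later is not.\<close>

definition smooth_fun :: "('m, 'e::euclidean_space) atlas \<Rightarrow> 'm set \<Rightarrow> ('m \<Rightarrow> real) \<Rightarrow> bool" where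
  "smooth_fun A W f \<longleftrightarrow> (\<forall>(U, x)\<in>A. smooth_on (x ` (U \<inter> W)) (f \<circ> inv_into U x))"

definition smooth_near :: "('m, 'e::euclidean_space) atlas \<Rightarrow> 'm \<Rightarrow> ('m \<Rightarrow> real) \<Rightarrow> bool" where
  "smooth_near A p f \<longleftrightarrow> (\<exists>W. manifold_open A W \<and> p \<in> W \<and> smooth_fun A W f)"

text \<open>Derivative of \<open>f\<close> at \<open>p\<close> in the coordinate direction \<open>b\<close>; for a basis vector \<open>b\<close> this is the
  partial derivative with respect to the corresponding coordinate function of the chart.\<close>

definition chart_deriv ::
  "('m, 'e::euclidean_space) chart \<Rightarrow> 'e \<Rightarrow> ('m \<Rightarrow> real) \<Rightarrow> 'm \<Rightarrow> real" where
  "chart_deriv = (\<lambda>(U, x) b f p. frechet_derivative (f \<circ> inv_into U x) (at (x p)) b)"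


section \<open>Tangent vectors and vector fields\<close>

text \<open>A tangent vector at \<open>p\<close> is a directional derivative \<open>f \<mapsto> \<Sum>\<^sub>i \<xi>\<^sub>i \<partial>f/\<partial>x\<^sub>i (p)\<close> acting on the
  functions that are smooth near \<open>p\<close>. It is extended by \<open>0\<close> to all other functions, so that
  tangent vectors are equal iff they agree on the functions smooth near \<open>p\<close>. Vectors are added and
  negated pointwise as operators.\<close>

type_synonym 'm tvec = "('m \<Rightarrow> real) \<Rightarrow> real"
type_synonym 'm vfield = "'m \<Rightarrow> 'm tvec"
type_synonym 'm tbundle = "'m \<times> 'm tvec"

definition coord_vector ::
  "('m, 'e::euclidean_space) atlas \<Rightarrow> ('m, 'e) chart \<Rightarrow> 'e \<Rightarrow> 'm vfield" where
  "coord_vector A c \<xi> p = (\<lambda>f. if smooth_near A p f then chart_deriv c \<xi> f p else 0)"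

definition tangent_space :: "('m, 'e::euclidean_space) atlas \<Rightarrow> 'm \<Rightarrow> 'm tvec set" where
  "tangent_space A p = {coord_vector A c \<xi> p | c \<xi>. c \<in> A \<and> p \<in> fst c}"

definition smooth_field :: "('m, 'e::euclidean_space) atlas \<Rightarrow> 'm set \<Rightarrow> 'm vfield \<Rightarrow> bool" where
  "smooth_field A W X \<longleftrightarrow>
     (\<forall>p\<in>W. X p \<in> tangent_space A p) \<and>
     (\<forall>V f. manifold_open A V \<and> V \<subseteq> W \<and> smooth_fun A V f \<longrightarrow> smooth_fun A V (\<lambda>p. X p f))"

definition lie_bracket ::
  "('m, 'e::euclidean_space) atlas \<Rightarrow> 'm vfield \<Rightarrow> 'm vfield \<Rightarrow> 'm vfield" where
  "lie_bracket A X Y p =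
     (\<lambda>f. if smooth_near A p f then X p (\<lambda>q. Y q f) - Y p (\<lambda>q. X q f) else 0)"

text \<open>The differential at \<open>p\<close> of a map \<open>F\<close> into the manifold with atlas \<open>B\<close>.\<close>

definition push_forward ::
  "('l, 'd::euclidean_space) atlas \<Rightarrow> ('m \<Rightarrow> 'l) \<Rightarrow> 'm \<Rightarrow> 'm tvec \<Rightarrow> 'l tvec" where
  "push_forward B F p v = (\<lambda>\<phi>. if smooth_near B (F p) \<phi> then v (\<phi> \<circ> F) else 0)"


section \<open>Metrics and connections\<close>

definition riemannian_metric ::
  "('m, 'e::euclidean_space) atlas \<Rightarrow> ('m \<Rightarrow> 'm tvec \<Rightarrow> 'm tvec \<Rightarrow> real) \<Rightarrow> bool" where
  "riemannian_metric A h \<longleftrightarrow>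
     (\<forall>p\<in>points A. \<forall>v\<in>tangent_space A p. \<forall>w\<in>tangent_space A p.
        h p v w = h p w v \<and>
        (\<forall>v'\<in>tangent_space A p. h p (v + v') w = h p v w + h p v' w) \<and>
        (\<forall>a. h p (\<lambda>f. a * v f) w = a * h p v w) \<and>
        (v \<noteq> 0 \<longrightarrow> h p v v > 0)) \<and>
     (\<forall>W X Y. manifold_open A W \<and> smooth_field A W X \<and> smooth_field A W Y \<longrightarrow>
        smooth_fun A W (\<lambda>p. h p (X p) (Y p)))"

text \<open>An affine connection is treated as an operator on vector fields defined on arbitrary open sets,
  compatible with restriction. The operator acts on total functions; the locality clause says that
  on an open set \<open>W\<close> its value only depends on the restrictions of its arguments to \<open>W\<close>.\<close>

type_synonym 'm conn = "'m vfield \<Rightarrow> 'm vfield \<Rightarrow> 'm vfield"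

definition affine_connection ::
  "('m, 'e::euclidean_space) atlas \<Rightarrow> 'm conn \<Rightarrow> bool" where
  "affine_connection A nabla \<longleftrightarrow>
     (\<forall>W X Y. manifold_open A W \<and> smooth_field A W X \<and> smooth_field A W Y \<longrightarrow>
        smooth_field A W (nabla X Y) \<and>
        (\<forall>X' Y'. (\<forall>p\<in>W. X' p = X p \<and> Y' p = Y p) \<longrightarrow> (\<forall>p\<in>W. nabla X' Y' p = nabla X Y p)) \<and>
        (\<forall>Z. smooth_field A W Z \<longrightarrow>
           (\<forall>p\<in>W. nabla (X + Z) Y p = nabla X Y p + nabla Z Y p \<and> nabla X (Y + Z) p = nabla X Y p + nabla X Z p)) \<and>
        (\<forall>f. smooth_fun A W f \<longrightarrow>
           (\<forall>p\<in>W. nabla (\<lambda>q \<phi>. f q * X q \<phi>) Y p = (\<lambda>\<phi>. f p * nabla X Y p \<phi>) \<and>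
                   nabla X (\<lambda>q \<phi>. f q * Y q \<phi>) p = (\<lambda>\<phi>. X p f * Y p \<phi> + f p * nabla X Y p \<phi>))))"

definition torsion ::
  "('m, 'e::euclidean_space) atlas \<Rightarrow> 'm conn \<Rightarrow> 'm vfield \<Rightarrow> 'm vfield \<Rightarrow> 'm vfield" where
  "torsion A nabla X Y = nabla X Y - nabla Y X - lie_bracket A X Y"

definition curvature ::
  "('m, 'e::euclidean_space) atlas \<Rightarrow> 'm conn \<Rightarrow> 'm vfield \<Rightarrow> 'm vfield \<Rightarrow> 'm vfield \<Rightarrow> 'm vfield" where
  "curvature A nabla X Y Z = nabla X (nabla Y Z) - nabla Y (nabla X Z) - nabla (lie_bracket A X Y) Z"

definition torsion_free :: "('m, 'e::euclidean_space) atlas \<Rightarrow> 'm conn \<Rightarrow> bool" where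
  "torsion_free A nabla \<longleftrightarrow>
     (\<forall>W X Y. manifold_open A W \<and> smooth_field A W X \<and> smooth_field A W Y \<longrightarrow>
        (\<forall>p\<in>W. torsion A nabla X Y p = 0))"

definition curvature_free :: "('m, 'e::euclidean_space) atlas \<Rightarrow> 'm conn \<Rightarrow> bool" where
  "curvature_free A nabla \<longleftrightarrow>
     (\<forall>W X Y Z. manifold_open A W \<and> smooth_field A W X \<and> smooth_field A W Y \<and> smooth_field A W Z \<longrightarrow>
        (\<forall>p\<in>W. curvature A nabla X Y Z p = 0))"

definition dual_connections ::
  "('m, 'e::euclidean_space) atlas \<Rightarrow> ('m \<Rightarrow> 'm tvec \<Rightarrow> 'm tvec \<Rightarrow> real) \<Rightarrow> 'm conn \<Rightarrow> 'm conn \<Rightarrow> bool" where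
  "dual_connections A h nabla nabla' \<longleftrightarrow>
     affine_connection A nabla \<and> affine_connection A nabla' \<and>
     (\<forall>W X Y Z. manifold_open A W \<and> smooth_field A W X \<and> smooth_field A W Y \<and> smooth_field A W Z \<longrightarrow>
        (\<forall>p\<in>W. X p (\<lambda>q. h q (Y q) (Z q)) = h p (nabla X Y p) (Z p) + h p (Y p) (nabla' X Z p)))"

definition dually_flat ::
  "('m, 'e::euclidean_space) atlas \<Rightarrow> ('m \<Rightarrow> 'm tvec \<Rightarrow> 'm tvec \<Rightarrow> real) \<Rightarrow> 'm conn \<Rightarrow> 'm conn \<Rightarrow> bool" where
  "dually_flat A h nabla nabla' \<longleftrightarrow>
     riemannian_metric A h \<and> dual_connections A h nabla nabla' \<and>
     torsion_free A nabla \<and> curvature_free A nabla \<and> torsion_free A nabla' \<and> curvature_free A nabla'"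

text \<open>Metric compatibility \<open>X (h(Y,Z)) = h(\<nabla>\<^sub>X Y, Z) + h(Y, \<nabla>\<^sub>X Z)\<close> is self-duality.\<close>

definition levi_civita ::
  "('m, 'e::euclidean_space) atlas \<Rightarrow> ('m \<Rightarrow> 'm tvec \<Rightarrow> 'm tvec \<Rightarrow> real) \<Rightarrow> 'm conn \<Rightarrow> bool" where
  "levi_civita A h D \<longleftrightarrow> dual_connections A h D D \<and> torsion_free A D"

text \<open>\<open>christoffel A D c i j b p\<close> is \<open>\<Gamma>\<^sup>b\<^sub>i\<^sub>j(p)\<close>, the \<open>b\<close>-th coordinate \<open>dx\<^sub>b\<close> of the covariant
  derivative of \<open>\<partial>/\<partial>x\<^sub>j\<close> in the direction \<open>\<partial>/\<partial>x\<^sub>i\<close>.\<close>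

definition christoffel ::
  "('m, real ^ 'n) atlas \<Rightarrow> 'm conn \<Rightarrow> ('m, real ^ 'n) chart \<Rightarrow> 'n \<Rightarrow> 'n \<Rightarrow> 'n \<Rightarrow> 'm \<Rightarrow> real" where
  "christoffel A D c i j b p =
     D (coord_vector A c (axis i 1)) (coord_vector A c (axis j 1)) p (\<lambda>q. snd c q $ b)"

definition affine_coordinates ::
  "('m, real ^ 'n) atlas \<Rightarrow> 'm conn \<Rightarrow> ('m, real ^ 'n) chart \<Rightarrow> bool" where
  "affine_coordinates A nabla c \<longleftrightarrow> c \<in> A \<and> (\<forall>p\<in>fst c. \<forall>i j b. christoffel A nabla c i j b p = 0)"


section \<open>The tangent bundle\<close>

definition bundle_over :: "('m, 'e::euclidean_space) atlas \<Rightarrow> 'm set \<Rightarrow> 'm tbundle set" where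
  "bundle_over A U = {(p, v). p \<in> U \<and> v \<in> tangent_space A p}"

text \<open>The coordinates \<open>(x\<^sub>i \<circ> \<pi>, dx\<^sub>i)\<close> on the preimage of a coordinate domain.\<close>

definition tangent_chart ::
  "('m, real ^ 'n) atlas \<Rightarrow> ('m, real ^ 'n) chart \<Rightarrow> ('m tbundle, (real ^ 'n) \<times> (real ^ 'n)) chart" where
  "tangent_chart A = (\<lambda>(U, x). (bundle_over A U, \<lambda>(p, v). (x p, \<chi> i. v (\<lambda>q. x q $ i))))"

definition tangent_atlas ::
  "('m, real ^ 'n) atlas \<Rightarrow> ('m tbundle, (real ^ 'n) \<times> (real ^ 'n)) atlas" where
  "tangent_atlas A = tangent_chart A ` A"

definition deriv_x ::
  "('m, real ^ 'n) atlas \<Rightarrow> ('m, real ^ 'n) chart \<Rightarrow> 'n \<Rightarrow> ('m tbundle \<Rightarrow> real) \<Rightarrow> 'm tbundle \<Rightarrow> real" where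
  "deriv_x A c i = chart_deriv (tangent_chart A c) (axis i 1, 0)"

definition deriv_xdot ::
  "('m, real ^ 'n) atlas \<Rightarrow> ('m, real ^ 'n) chart \<Rightarrow> 'n \<Rightarrow> ('m tbundle \<Rightarrow> real) \<Rightarrow> 'm tbundle \<Rightarrow> real" where
  "deriv_xdot A c i = chart_deriv (tangent_chart A c) (0, axis i 1)"


section \<open>Dombrowski's construction\<close>

text \<open>The connector \<open>K\<close> maps \<open>a \<in> T\<^sub>u(TM)\<close> to a tangent vector of \<open>M\<close> at \<open>\<pi>(u)\<close>, linearly on each
  \<open>T\<^sub>u(TM)\<close>. Linearity has to be required for uniqueness, since \<open>Y\<^sub>* X\<close> is never a nonzero vertical
  vector.\<close>

definition is_connector ::
  "('m, real ^ 'n) atlas \<Rightarrow> 'm conn \<Rightarrow> ('m tbundle \<Rightarrow> 'm tbundle tvec \<Rightarrow> 'm tvec) \<Rightarrow> bool" where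
  "is_connector A nabla K \<longleftrightarrow>
     (\<forall>u\<in>bundle_over A (points A). \<forall>a\<in>tangent_space (tangent_atlas A) u.
        K u a \<in> tangent_space A (fst u) \<and>
        (\<forall>b\<in>tangent_space (tangent_atlas A) u. K u (a + b) = K u a + K u b) \<and>
        (\<forall>r. K u (\<lambda>\<phi>. r * a \<phi>) = (\<lambda>\<phi>. r * K u a \<phi>))) \<and>
     (\<forall>W X Y. manifold_open A W \<and> smooth_field A W X \<and> smooth_field A W Y \<longrightarrow>
        (\<forall>p\<in>W. K (p, Y p) (push_forward (tangent_atlas A) (\<lambda>q. (q, Y q)) p (X p)) = nabla X Y p))"

abbreviation push_proj :: "('m, real ^ 'n) atlas \<Rightarrow> 'm tbundle \<Rightarrow> 'm tbundle tvec \<Rightarrow> 'm tvec" where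
  "push_proj A \<equiv> push_forward A fst"

definition dombrowski_g ::
  "('m, real ^ 'n) atlas \<Rightarrow> ('m \<Rightarrow> 'm tvec \<Rightarrow> 'm tvec \<Rightarrow> real) \<Rightarrow> ('m tbundle \<Rightarrow> 'm tbundle tvec \<Rightarrow> 'm tvec) \<Rightarrow>
     'm tbundle \<Rightarrow> 'm tbundle tvec \<Rightarrow> 'm tbundle tvec \<Rightarrow> real" where
  "dombrowski_g A h K u a b =
     h (fst u) (push_proj A u a) (push_proj A u b) + h (fst u) (K u a) (K u b)"

text \<open>\<open>J (u, v, w) = (u, -w, v)\<close> under the identification \<open>a \<mapsto> (u, \<pi>\<^sub>* a, K a)\<close>.\<close>

definition dombrowski_J ::
  "('m, real ^ 'n) atlas \<Rightarrow> ('m tbundle \<Rightarrow> 'm tbundle tvec \<Rightarrow> 'm tvec) \<Rightarrow>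
     'm tbundle \<Rightarrow> 'm tbundle tvec \<Rightarrow> 'm tbundle tvec" where
  "dombrowski_J A K u a =
     (THE b. b \<in> tangent_space (tangent_atlas A) u \<and> push_proj A u b = - K u a \<and> K u b = push_proj A u a)"

definition dombrowski_omega ::
  "('m, real ^ 'n) atlas \<Rightarrow> ('m \<Rightarrow> 'm tvec \<Rightarrow> 'm tvec \<Rightarrow> real) \<Rightarrow> ('m tbundle \<Rightarrow> 'm tbundle tvec \<Rightarrow> 'm tvec) \<Rightarrow>
     'm tbundle \<Rightarrow> 'm tbundle tvec \<Rightarrow> 'm tbundle tvec \<Rightarrow> real" where
  "dombrowski_omega A h K u a b = dombrowski_g A h K u (dombrowski_J A K u a) b"


section \<open>Kaehler functions\<close>

definition hamiltonian_field ::
  "('m, 'e::euclidean_space) atlas \<Rightarrow> ('m \<Rightarrow> 'm tvec \<Rightarrow> 'm tvec \<Rightarrow> real) \<Rightarrow> ('m \<Rightarrow> real) \<Rightarrow> 'm vfield" where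
  "hamiltonian_field A \<omega> f p =
     (THE a. a \<in> tangent_space A p \<and> (\<forall>b\<in>tangent_space A p. \<omega> p a b = b f))"

text \<open>The Lie derivative of the covariant 2-tensor \<open>g\<close> along \<open>X\<close>, evaluated on vector fields \<open>Y\<close>, \<open>Z\<close>.\<close>

definition lie_derivative ::
  "('m, 'e::euclidean_space) atlas \<Rightarrow> 'm vfield \<Rightarrow> ('m \<Rightarrow> 'm tvec \<Rightarrow> 'm tvec \<Rightarrow> real) \<Rightarrow>
     'm vfield \<Rightarrow> 'm vfield \<Rightarrow> 'm \<Rightarrow> real" where
  "lie_derivative A X g Y Z p =
     X p (\<lambda>q. g q (Y q) (Z q)) - g p (lie_bracket A X Y p) (Z p) - g p (Y p) (lie_bracket A X Z p)"

definition kaehler_function_on ::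
  "('m, 'e::euclidean_space) atlas \<Rightarrow> ('m \<Rightarrow> 'm tvec \<Rightarrow> 'm tvec \<Rightarrow> real) \<Rightarrow>
     ('m \<Rightarrow> 'm tvec \<Rightarrow> 'm tvec \<Rightarrow> real) \<Rightarrow> 'm set \<Rightarrow> ('m \<Rightarrow> real) \<Rightarrow> bool" where
  "kaehler_function_on A g \<omega> W f \<longleftrightarrow>
     smooth_fun A W f \<and>
     (\<forall>V Y Z. manifold_open A V \<and> V \<subseteq> W \<and> smooth_field A V Y \<and> smooth_field A V Z \<longrightarrow>
        (\<forall>p\<in>V. lie_derivative A (hamiltonian_field A \<omega> f) g Y Z p = 0))"

end

theory Submission
  imports Defs
begin

text \<open>In coordinates affine for the connection, the connector is the projection
  \<open>(\<alpha>, \<beta>) \<mapsto> \<beta>\<close>, so that, with \<open>H\<close> the matrix of the metric, \<open>g = H \<oplus> H\<close>,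
  \<open>J (\<alpha>, \<beta>) = (- \<beta>, \<alpha>)\<close>, and the Hamiltonian field of \<open>f\<close> is
  \<open>X = (P, Q)\<close> with \<open>H P = \<partial>f/\<partial>xdot\<close> and \<open>H Q = - \<partial>f/\<partial>x\<close>. Differentiating these two relations expresses
  the components of the Lie derivative of \<open>g\<close> along \<open>X\<close> by second derivatives of \<open>f\<close> and the contractions of
  \<open>\<partial>H\<close> with \<open>P\<close> and \<open>Q\<close>. Since the dual connection is torsion-free, \<open>\<partial>\<^sub>k H\<^sub>i\<^sub>j\<close> is totally
  symmetric, hence equal to \<open>2 \<Sum>\<^sub>b \<Gamma>\<^sup>b\<^sub>i\<^sub>j H\<^sub>b\<^sub>k\<close> by Koszul's formula, and these contractions become
  the right-hand sides of the two equations.\<close>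

section \<open>Calculus of smooth functions\<close>

text \<open>The Hamiltonian field is given by a definite description and its values are operators on
  functions, so it cannot be differentiated as it stands. Therefore \<open>P\<close> and
  \<open>Q\<close> are built first, as smooth functions of the coordinates of \<open>TM\<close>, and
  are identified with the components of the field afterwards. Their signs come from \<open>\<omega>
  (X, (c, d)) = g ((- Q, P), (c, d)) = h (P, d) - h (Q, c)\<close>, which has to be the differential
  of \<open>f\<close> at \<open>(c, d)\<close>. The total symmetry arises as follows. In affine
  coordinates the term with \<open>nabla\<close> drops out of the duality identity, so the
  derivative of \<open>h (a, b)\<close> along \<open>c\<close> is \<open>h (a, nabla' c b)\<close>
  for constant fields; the torsion of \<open>nabla'\<close> vanishes and constant fields commute, so
  \<open>b\<close> and \<open>c\<close> may be exchanged. The Lie derivative has four blocks but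
  there are only two equations: both diagonal blocks amount to the second equation, both mixed
  blocks to the first. Charts of \<open>M\<close> and of \<open>TM\<close> are treated by the same
  calculus, which is therefore set up for atlases that need not be maximal.\<close>

abbreviation fd :: "('a::real_normed_vector \<Rightarrow> 'b::real_normed_vector) \<Rightarrow> 'a \<Rightarrow> 'a \<Rightarrow> 'b" where
  "fd f z \<equiv> frechet_derivative f (at z)"

lemma fd_eqI: "(f has_derivative f') (at z) \<Longrightarrow> fd f z = f'"
  using frechet_derivative_at by metis

lemma fd_has_derivative: "f differentiable (at z) \<Longrightarrow> (f has_derivative fd f z) (at z)"
  using frechet_derivative_works by blast

text \<open>\<open>frechet_derivative\<close> is a choice among the derivatives at \<open>z\<close>,
  so it suffices that \<open>f\<close> and \<open>g\<close> have the same ones, even if there are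
  none. Functions read through \<open>inv_into U x\<close> are controlled only on the image of the
  chart, and this lemma replaces one such function by another under a derivative.\<close>

lemma fd_cong_open:
  assumes "open S" "z \<in> S" "\<And>z. z \<in> S \<Longrightarrow> f z = g z"
  shows "fd f z = fd g z"
proof -
  have "(f has_derivative f') (at z) \<longleftrightarrow> (g has_derivative f') (at z)" for f'
    using has_derivative_transform_within_open[OF _ assms(1,2)] assms(3) by metis
  then show ?thesis by (simp add: frechet_derivative_def)
qed

lemma differentiable_cong_open:
  assumes "open S" "z \<in> S" "\<And>z. z \<in> S \<Longrightarrow> f z = g z"
  shows "f differentiable (at z) \<longleftrightarrow> g differentiable (at z)"
  unfolding differentiable_def
  using has_derivative_transform_within_open[OF _ assms(1,2)] assms(3) by metis

section \<open>Closure properties of C^k functions\<close>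

lemma Ck_on_cong:
  assumes "open S" "\<And>z. z \<in> S \<Longrightarrow> f z = g z"
  shows "Ck_on k S f \<longleftrightarrow> Ck_on k S g"
  using assms(2)
proof (induction k arbitrary: f g)
  case 0
  then show ?case by (simp cong: continuous_on_cong)
next
  case (Suc k)
  have "f differentiable (at z) \<longleftrightarrow> g differentiable (at z)" if "z \<in> S" for z
    using assms(1) that Suc.prems by (rule differentiable_cong_open)
  moreover have "Ck_on k S (\<lambda>z. fd f z v) \<longleftrightarrow> Ck_on k S (\<lambda>z. fd g z v)" for v
    using fd_cong_open[OF assms(1) _ Suc.prems] by (intro Suc.IH) simp
  ultimately show ?case by auto
qed

lemma Ck_on_subset: "Ck_on k S f \<Longrightarrow> T \<subseteq> S \<Longrightarrow> Ck_on k T f"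
  by (induction k arbitrary: f) (auto intro: continuous_on_subset)

lemma Ck_on_Suc_differentiable: "Ck_on (Suc k) S f \<Longrightarrow> z \<in> S \<Longrightarrow> f differentiable (at z)"
  by simp

lemma Ck_on_SucD: "Ck_on (Suc k) S f \<Longrightarrow> Ck_on k S f"
proof (induction k arbitrary: f)
  case 0
  then show ?case
    by (auto intro!: continuous_at_imp_continuous_on differentiable_imp_continuous_within)
qed auto

lemma Ck_on_const: "Ck_on k S (\<lambda>_. c)"
  by (induction k arbitrary: c) auto

lemma Ck_on_zero: "Ck_on k S (\<lambda>_. 0)"
  by (rule Ck_on_const)

lemma Ck_on_linear:
  assumes "bounded_linear L"
  shows "Ck_on k S L"
proof (cases k)
  case 0
  then show ?thesis using assms by (simp add: linear_continuous_on)
next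
  case (Suc m)
  have "(L has_derivative L) (at z)" for z
    using assms by (rule bounded_linear_imp_has_derivative)
  then show ?thesis
    using Suc fd_eqI[of L L] by (auto simp: Ck_on_const differentiable_def)
qed

text \<open>The induction step of the closure properties below: from an explicit formula for the
  derivative, only its dependence on the base point, for each fixed direction, has to be
  C^k.\<close>

lemma Ck_on_Suc_has_derivativeI:
  assumes "open S" "\<And>z. z \<in> S \<Longrightarrow> (f has_derivative f' z) (at z)" "\<And>v. Ck_on k S (\<lambda>z. f' z v)"
  shows "Ck_on (Suc k) S f"
proof -
  have "Ck_on k S (\<lambda>z. fd f z v)" for v
  proof -
    have "fd f z v = f' z v" if "z \<in> S" for z
      using fd_eqI[OF assms(2)[OF that]] by simp
    then show ?thesis using Ck_on_cong[OF assms(1), of "\<lambda>z. fd f z v" "\<lambda>z. f' z v" k] assms(3) by simp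
  qed
  moreover have "f differentiable (at z)" if "z \<in> S" for z
    using assms(2)[OF that] by (rule differentiableI)
  ultimately show ?thesis by simp
qed

lemma Ck_on_Suc_has_derivative: "Ck_on (Suc k) S f \<Longrightarrow> z \<in> S \<Longrightarrow> (f has_derivative fd f z) (at z)"
  by (simp add: fd_has_derivative)

lemma Ck_on_Suc_fd: "Ck_on (Suc k) S f \<Longrightarrow> Ck_on k S (\<lambda>z. fd f z v)"
  by simp

lemma Ck_on_add:
  assumes "open S" "Ck_on k S f" "Ck_on k S g"
  shows "Ck_on k S (\<lambda>z. f z + g z)"
  using assms(2,3)
proof (induction k arbitrary: f g)
  case 0
  then show ?case by (simp add: continuous_on_add)
next
  case (Suc k)
  show ?case
    by (rule Ck_on_Suc_has_derivativeI[OF assms(1) has_derivative_add])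
      (rule Ck_on_Suc_has_derivative[OF Suc.prems(1)] Ck_on_Suc_has_derivative[OF Suc.prems(2)]
        Suc.IH Ck_on_Suc_fd[OF Suc.prems(1)] Ck_on_Suc_fd[OF Suc.prems(2)] | assumption)+
qed

text \<open>The Leibniz rule yields products of one factor with a derivative of the other, all of
  class C^k; hence the induction runs over all pairs of factors.\<close>

lemma Ck_on_bilinear:
  assumes "bounded_bilinear B" and "open S" "Ck_on k S f" "Ck_on k S g"
  shows "Ck_on k S (\<lambda>z. B (f z) (g z))"
  using assms(3,4)
proof (induction k arbitrary: f g)
  case 0
  then show ?case by (simp add: bounded_bilinear.continuous_on[OF assms(1)])
next
  case (Suc k)
  show ?case
  proof (rule Ck_on_Suc_has_derivativeI[OF assms(2) bounded_bilinear.FDERIV[OF assms(1)]])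
    show "(f has_derivative fd f z) (at z)" "(g has_derivative fd g z) (at z)" if "z \<in> S" for z
      using Suc.prems that by (auto intro: Ck_on_Suc_has_derivative)
    show "Ck_on k S (\<lambda>z. B (f z) (fd g z v) + B (fd f z v) (g z))" for v
      by (intro Ck_on_add[OF assms(2)] Suc.IH Ck_on_Suc_fd[OF Suc.prems(1)] Ck_on_Suc_fd[OF Suc.prems(2)]
        Ck_on_SucD[OF Suc.prems(1)] Ck_on_SucD[OF Suc.prems(2)])
  qed
qed

lemma Ck_on_bounded_linear_compose:
  assumes "bounded_linear L" "open S" "Ck_on k S f"
  shows "Ck_on k S (\<lambda>z. L (f z))"
  using assms(3)
proof (induction k arbitrary: f)
  case 0
  then show ?case using bounded_linear.continuous_on[OF assms(1)] by simp
next
  case (Suc k)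
  show ?case
    by (rule Ck_on_Suc_has_derivativeI[OF assms(2) bounded_linear.has_derivative[OF assms(1)]])
      (use Suc in \<open>auto intro: Ck_on_Suc_has_derivative\<close>)
qed

lemma Ck_on_sum:
  assumes "open S" "\<And>i. i \<in> I \<Longrightarrow> Ck_on k S (f i)"
  shows "Ck_on k S (\<lambda>z. \<Sum>i\<in>I. f i z)"
  using assms(2) by (induction I rule: infinite_finite_induct) (simp_all add: Ck_on_zero Ck_on_add[OF assms(1)])

lemma linear_expand_Basis:
  fixes L :: "'a::euclidean_space \<Rightarrow> 'b::real_vector"
  assumes "linear L"
  shows "L v = (\<Sum>b\<in>Basis. (v \<bullet> b) *\<^sub>R L b)"
proof -
  interpret linear L by fact
  have "L v = L (\<Sum>b\<in>Basis. (v \<bullet> b) *\<^sub>R b)" by (simp add: euclidean_representation)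
  then show ?thesis by (simp only: sum scale)
qed

text \<open>The chain rule produces a derivative of \<open>f\<close> in the direction
  \<open>fd g z v\<close>, which varies with \<open>z\<close>, whereas \<open>Ck_on\<close> speaks
  of fixed directions. Expanding that direction in \<open>Basis\<close> leaves a sum of products to
  which the induction hypothesis applies.\<close>

lemma Ck_on_compose:
  fixes f :: "'a::euclidean_space \<Rightarrow> 'b::real_normed_vector" and g :: "'c::euclidean_space \<Rightarrow> 'a"
  assumes "open S" "g ` S \<subseteq> T" "Ck_on k T f" "Ck_on k S g"
  shows "Ck_on k S (\<lambda>z. f (g z))"
  using assms(3,4)
proof (induction k arbitrary: f)
  case 0
  then show ?case using continuous_on_compose2[OF _ _ assms(2)] by auto
next
  case (Suc k)
  have f: "(f has_derivative fd f (g z)) (at (g z))" if "z \<in> S" for z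
    using that assms(2) by (intro Ck_on_Suc_has_derivative[OF Suc.prems(1)]) auto
  have g: "(g has_derivative fd g z) (at z)" if "z \<in> S" for z
    using that by (rule Ck_on_Suc_has_derivative[OF Suc.prems(2)])
  have expand: "fd f (g z) (fd g z v) = (\<Sum>b\<in>Basis. (fd g z v \<bullet> b) *\<^sub>R fd f (g z) b)" if "z \<in> S" for z v
    by (rule linear_expand_Basis[OF has_derivative_linear[OF f[OF that]]])
  show ?case
  proof (rule Ck_on_Suc_has_derivativeI[OF assms(1)])
    show "((\<lambda>z. f (g z)) has_derivative (\<lambda>v. \<Sum>b\<in>Basis. (fd g z v \<bullet> b) *\<^sub>R fd f (g z) b)) (at z)"
      if "z \<in> S" for z
      using has_derivative_compose[OF g[OF that] f[OF that]] expand[OF that] by simp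
    show "Ck_on k S (\<lambda>z. \<Sum>b\<in>Basis. (fd g z v \<bullet> b) *\<^sub>R fd f (g z) b)" for v
      by (intro Ck_on_sum[OF assms(1)] Ck_on_bilinear[OF bounded_bilinear_scaleR assms(1)]
          Ck_on_bounded_linear_compose[OF bounded_linear_inner_left assms(1)] Ck_on_Suc_fd[OF Suc.prems(2)]
          Suc.IH[OF Ck_on_Suc_fd[OF Suc.prems(1)]] Ck_on_SucD[OF Suc.prems(2)])
  qed
qed

text \<open>The derivative of the inverse is a product of the inverse itself, C^k by the induction
  hypothesis, and a derivative of \<open>f\<close>.\<close>

lemma Ck_on_inverse:
  fixes f :: "'a::euclidean_space \<Rightarrow> real"
  assumes "open S" "\<And>z. z \<in> S \<Longrightarrow> f z \<noteq> 0" "Ck_on k S f"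
  shows "Ck_on k S (\<lambda>z. inverse (f z))"
  using assms(3)
proof (induction k)
  case 0
  then show ?case using assms(2) by (simp add: continuous_on_inverse)
next
  case (Suc k)
  have inv: "Ck_on k S (\<lambda>z. inverse (f z))" using Suc.IH Ck_on_SucD[OF Suc.prems] .
  show ?case
  proof (rule Ck_on_Suc_has_derivativeI[OF assms(1) Deriv.has_derivative_inverse])
    show "Ck_on k S (\<lambda>z. - (inverse (f z) * fd f z v * inverse (f z)))" for v
      by (intro Ck_on_bounded_linear_compose[OF bounded_linear_minus[OF bounded_linear_ident] assms(1)]
          Ck_on_bilinear[OF bounded_bilinear_mult assms(1)] inv Ck_on_Suc_fd[OF Suc.prems])
  qed (use assms(2) Ck_on_Suc_has_derivative[OF Suc.prems] in auto)
qed

section \<open>Closure properties of smooth functions\<close>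

lemma smooth_on_cong: "open S \<Longrightarrow> (\<And>z. z \<in> S \<Longrightarrow> f z = g z) \<Longrightarrow> smooth_on S f \<longleftrightarrow> smooth_on S g"
  unfolding smooth_on_def using Ck_on_cong by blast

lemma smooth_on_transform: "smooth_on S g \<Longrightarrow> open S \<Longrightarrow> (\<And>z. z \<in> S \<Longrightarrow> f z = g z) \<Longrightarrow> smooth_on S f"
  using smooth_on_cong[of S f g] by simp

lemma smooth_on_subset: "smooth_on S f \<Longrightarrow> T \<subseteq> S \<Longrightarrow> smooth_on T f"
  unfolding smooth_on_def using Ck_on_subset by blast

lemma smooth_on_differentiable: "smooth_on S f \<Longrightarrow> z \<in> S \<Longrightarrow> f differentiable (at z)"
  unfolding smooth_on_def using Ck_on_Suc_differentiable by blast

lemma smooth_on_has_derivative: "smooth_on S f \<Longrightarrow> z \<in> S \<Longrightarrow> (f has_derivative fd f z) (at z)"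
  by (intro fd_has_derivative smooth_on_differentiable)

lemma smooth_on_fd: "smooth_on S f \<Longrightarrow> smooth_on S (\<lambda>z. fd f z v)"
  unfolding smooth_on_def using Ck_on_Suc_fd by blast

lemma smooth_on_continuous: "smooth_on S f \<Longrightarrow> continuous_on S f"
  unfolding smooth_on_def using Ck_on.simps(1) by blast

lemma smooth_on_const: "smooth_on S (\<lambda>_. c)"
  by (simp add: smooth_on_def Ck_on_const)

lemma smooth_on_linear: "bounded_linear L \<Longrightarrow> smooth_on S L"
  by (simp add: smooth_on_def Ck_on_linear)

lemma smooth_on_add: "open S \<Longrightarrow> smooth_on S f \<Longrightarrow> smooth_on S g \<Longrightarrow> smooth_on S (\<lambda>z. f z + g z)"
  by (simp add: smooth_on_def Ck_on_add)

lemma smooth_on_sum: "open S \<Longrightarrow> (\<And>i. i \<in> I \<Longrightarrow> smooth_on S (f i)) \<Longrightarrow> smooth_on S (\<lambda>z. \<Sum>i\<in>I. f i z)"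
  by (simp add: smooth_on_def Ck_on_sum)

lemma smooth_on_bilinear:
  "bounded_bilinear B \<Longrightarrow> open S \<Longrightarrow> smooth_on S f \<Longrightarrow> smooth_on S g \<Longrightarrow> smooth_on S (\<lambda>z. B (f z) (g z))"
  by (simp add: smooth_on_def Ck_on_bilinear)

lemmas smooth_on_mult = smooth_on_bilinear[OF bounded_bilinear_mult]

lemma smooth_on_linear_compose:
  "bounded_linear L \<Longrightarrow> open S \<Longrightarrow> smooth_on S f \<Longrightarrow> smooth_on S (\<lambda>z. L (f z))"
  by (simp add: smooth_on_def Ck_on_bounded_linear_compose)

lemma smooth_on_compose:
  "open S \<Longrightarrow> g ` S \<subseteq> T \<Longrightarrow> smooth_on T f \<Longrightarrow> smooth_on S g \<Longrightarrow> smooth_on S (\<lambda>z. f (g z))"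
  for f :: "'a::euclidean_space \<Rightarrow> 'b::real_normed_vector" and g :: "'c::euclidean_space \<Rightarrow> 'a"
  unfolding smooth_on_def using Ck_on_compose by blast

lemma smooth_on_inverse:
  "open S \<Longrightarrow> (\<And>z. z \<in> S \<Longrightarrow> f z \<noteq> 0) \<Longrightarrow> smooth_on S f \<Longrightarrow> smooth_on S (\<lambda>z. inverse (f z))"
  for f :: "'a::euclidean_space \<Rightarrow> real"
  by (simp add: smooth_on_def Ck_on_inverse)

lemma smooth_on_prod:
  fixes f :: "'i \<Rightarrow> 'a::euclidean_space \<Rightarrow> real"
  assumes "open S" "\<And>i. i \<in> I \<Longrightarrow> smooth_on S (f i)"
  shows "smooth_on S (\<lambda>z. \<Prod>i\<in>I. f i z)"
  using assms(2)
  by (induction I rule: infinite_finite_induct) (simp_all add: smooth_on_const smooth_on_mult[OF assms(1)])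

lemma smooth_on_Pair:
  assumes "open S" "smooth_on S f" "smooth_on S g"
  shows "smooth_on S (\<lambda>z. (f z, g z))"
proof -
  have "bounded_linear (\<lambda>a::'b. (a, 0::'c))" "bounded_linear (\<lambda>b::'c. (0::'b, b))"
    by (intro bounded_linear_intros)+
  then have "smooth_on S (\<lambda>z. (f z, 0) + (0, g z))"
    using assms by (intro smooth_on_add smooth_on_linear_compose[where L="\<lambda>a. (a, 0)"]
        smooth_on_linear_compose[where L="\<lambda>b. (0, b)"])
  then show ?thesis by simp
qed

lemma smooth_on_components:
  fixes f :: "'a::euclidean_space \<Rightarrow> 'b::euclidean_space"
  assumes "open S" "\<And>b. b \<in> Basis \<Longrightarrow> smooth_on S (\<lambda>z. f z \<bullet> b)"
  shows "smooth_on S f"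
proof -
  have "smooth_on S (\<lambda>z. \<Sum>b\<in>Basis. (f z \<bullet> b) *\<^sub>R b)"
    using assms by (intro smooth_on_sum smooth_on_linear_compose[OF bounded_linear_scaleR_left])
  then show ?thesis by (simp add: euclidean_representation)
qed

text \<open>Differentiation in a direction that moves with the point. Derivatives along vector
  fields and the fibre part of the transition maps of \<open>TM\<close> have this form; again the
  direction is expanded in \<open>Basis\<close>.\<close>

lemma smooth_on_fd_apply:
  fixes f :: "'a::euclidean_space \<Rightarrow> 'b::real_normed_vector" and y :: "'c::euclidean_space \<Rightarrow> 'a"
  assumes "open S" "smooth_on T f" "smooth_on S g" "smooth_on S y" "g ` S \<subseteq> T"
  shows "smooth_on S (\<lambda>z. fd f (g z) (y z))"
proof -
  have "fd f (g z) (y z) = (\<Sum>b\<in>Basis. (y z \<bullet> b) *\<^sub>R fd f (g z) b)" if "z \<in> S" for z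
    using assms that
    by (intro linear_expand_Basis linear_frechet_derivative smooth_on_differentiable[OF assms(2)]) auto
  moreover have "smooth_on S (\<lambda>z. \<Sum>b\<in>Basis. (y z \<bullet> b) *\<^sub>R fd f (g z) b)"
  proof (rule smooth_on_sum[OF assms(1)])
    fix b :: 'a
    have "smooth_on S (\<lambda>z. fd f (g z) b)"
      using smooth_on_compose[OF assms(1,5) smooth_on_fd[OF assms(2)] assms(3)] .
    then show "smooth_on S (\<lambda>z. (y z \<bullet> b) *\<^sub>R fd f (g z) b)"
      by (intro smooth_on_bilinear[OF bounded_bilinear_scaleR]
          smooth_on_linear_compose[OF bounded_linear_inner_left] assms)
  qed
  ultimately show ?thesis
    using smooth_on_cong[OF assms(1), of "\<lambda>z. fd f (g z) (y z)" "\<lambda>z. \<Sum>b\<in>Basis. (y z \<bullet> b) *\<^sub>R fd f (g z) b"]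
    by blast
qed

text \<open>Symmetry of second derivatives: both mixed derivatives approximate the same second difference quotient.\<close>

lemma second_difference_mvt:
  fixes f :: "'a::euclidean_space \<Rightarrow> real"
  assumes S: "smooth_on S f" and r: "r > 0"
    and sub: "\<And>s t. 0 \<le> s \<Longrightarrow> s \<le> r \<Longrightarrow> 0 \<le> t \<Longrightarrow> t \<le> r \<Longrightarrow> z + s *\<^sub>R v + t *\<^sub>R w \<in> S"
  obtains s t where "0 < s" "s < r" "0 < t" "t < r"
    "f (z + r *\<^sub>R v + r *\<^sub>R w) - f (z + r *\<^sub>R v) - f (z + r *\<^sub>R w) + f z =
      r\<^sup>2 * fd (\<lambda>z. fd f z v) (z + s *\<^sub>R v + t *\<^sub>R w) w"
proof -
  have line: "((\<lambda>t. g (a + t *\<^sub>R b)) has_real_derivative fd g (a + t *\<^sub>R b) b) (at t)"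
    if g: "smooth_on S g" "a + t *\<^sub>R b \<in> S" for g :: "'a \<Rightarrow> real" and a b t
  proof -
    have d: "((\<lambda>t. a + t *\<^sub>R b) has_derivative (\<lambda>t. t *\<^sub>R b)) (at t)"
      by (auto intro!: derivative_eq_intros)
    have lin: "linear (fd g (a + t *\<^sub>R b))"
      using g by (intro linear_frechet_derivative smooth_on_differentiable)
    show ?thesis
      using has_derivative_compose[OF d smooth_on_has_derivative[OF g]]
      by (simp add: has_field_derivative_def linear_scale[OF lin] mult.commute[of _ "fd g (a + t *\<^sub>R b) b"])
  qed
  \<comment> \<open>The mean value theorem is used twice: in \<open>s\<close>, for the difference of
    \<open>f\<close> on two parallel segments with direction \<open>v\<close>, and then in
    \<open>t\<close>, for the derivative of \<open>f\<close> along \<open>v\<close>.\<close>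
  have 1: "((\<lambda>s. f ((z + r *\<^sub>R w) + s *\<^sub>R v) - f (z + s *\<^sub>R v)) has_real_derivative
      fd f ((z + r *\<^sub>R w) + s *\<^sub>R v) v - fd f (z + s *\<^sub>R v) v) (at s)" if "0 \<le> s" "s \<le> r" for s
    using sub[OF that, of r] sub[OF that, of 0] r
    by (intro DERIV_diff line[OF S]) (auto simp: algebra_simps)
  obtain s where s: "0 < s" "s < r" and fs: "(f (z + r *\<^sub>R w + r *\<^sub>R v) - f (z + r *\<^sub>R v)) -
      (f (z + r *\<^sub>R w + 0 *\<^sub>R v) - f (z + 0 *\<^sub>R v)) =
      (r - 0) * (fd f ((z + r *\<^sub>R w) + s *\<^sub>R v) v - fd f (z + s *\<^sub>R v) v)"
    using MVT2[OF r 1] by blast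
  have 2: "((\<lambda>t. fd f ((z + s *\<^sub>R v) + t *\<^sub>R w) v) has_real_derivative
      fd (\<lambda>z. fd f z v) ((z + s *\<^sub>R v) + t *\<^sub>R w) w) (at t)" if "0 \<le> t" "t \<le> r" for t
    using sub[of s t] s that by (intro line smooth_on_fd S) auto
  obtain t where t: "0 < t" "t < r" and ft: "fd f ((z + s *\<^sub>R v) + r *\<^sub>R w) v - fd f ((z + s *\<^sub>R v) + 0 *\<^sub>R w) v =
      (r - 0) * fd (\<lambda>z. fd f z v) ((z + s *\<^sub>R v) + t *\<^sub>R w) w"
    using MVT2[OF r 2] by blast
  have "f (z + r *\<^sub>R v + r *\<^sub>R w) - f (z + r *\<^sub>R v) - f (z + r *\<^sub>R w) + f z =
      r * (fd f ((z + s *\<^sub>R v) + r *\<^sub>R w) v - fd f (z + s *\<^sub>R v) v)"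
    using fs by (simp add: algebra_simps)
  also have "\<dots> = r\<^sup>2 * fd (\<lambda>z. fd f z v) (z + s *\<^sub>R v + t *\<^sub>R w) w"
    using ft by (simp add: power2_eq_square)
  finally show ?thesis using that s t by blast
qed

lemma fd_commute:
  fixes f :: "'a::euclidean_space \<Rightarrow> real"
  assumes "open S" "smooth_on S f" "z \<in> S"
  shows "fd (\<lambda>z. fd f z v) z w = fd (\<lambda>z. fd f z w) z v"
proof (rule ccontr)
  define F where "F = (\<lambda>z. fd (\<lambda>z. fd f z v) z w)"
  define G where "G = (\<lambda>z. fd (\<lambda>z. fd f z w) z v)"
  \<comment> \<open>Half the gap: a value within \<open>\<epsilon>\<close> of \<open>F z\<close>
    cannot equal a value within \<open>\<epsilon>\<close> of \<open>G z\<close>.\<close>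
  define \<epsilon> where "\<epsilon> = \<bar>F z - G z\<bar> / 2"
  assume "\<not> ?thesis"
  then have \<epsilon>: "\<epsilon> > 0" by (simp add: \<epsilon>_def F_def G_def)
  have cont: "isCont F z" "isCont G z"
    using smooth_on_continuous[OF smooth_on_fd[OF smooth_on_fd[OF assms(2)]]] assms(1,3)
    by (auto simp: F_def G_def continuous_on_eq_continuous_at)
  have ev: "eventually (\<lambda>y. \<bar>F y - F z\<bar> < \<epsilon> \<and> \<bar>G y - G z\<bar> < \<epsilon> \<and> y \<in> S) (nhds z)"
    using \<epsilon> cont assms(1,3) unfolding continuous_at_imp_continuous_within
    by (intro eventually_conj eventually_nhds_in_open)
      (auto simp: isCont_def tendsto_at_iff_tendsto_nhds dist_real_def[symmetric] intro: tendstoD)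
  then obtain d where d: "d > 0" "\<And>y. dist y z < d \<Longrightarrow> \<bar>F y - F z\<bar> < \<epsilon> \<and> \<bar>G y - G z\<bar> < \<epsilon> \<and> y \<in> S"
    unfolding eventually_nhds_metric by blast
  \<comment> \<open>Small enough for the parallelogram with sides \<open>r *\<^sub>R v\<close> and
    \<open>r *\<^sub>R w\<close> to stay in the ball of radius \<open>d\<close>; the summand 1 keeps
    the denominator positive when both vectors vanish.\<close>
  define r where "r = d / (2 * (norm v + norm w + 1))"
  have n: "norm v + norm w + 1 > 0" by (smt (verit) norm_ge_zero)
  have r: "r > 0" using d(1) n by (simp add: r_def)
  have near: "dist (z + s *\<^sub>R v + t *\<^sub>R w) z < d" if "0 \<le> s" "s \<le> r" "0 \<le> t" "t \<le> r" for s t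
  proof -
    have "dist (z + s *\<^sub>R v + t *\<^sub>R w) z = norm (s *\<^sub>R v + t *\<^sub>R w)"
      by (simp add: dist_norm)
    also have "\<dots> \<le> s * norm v + t * norm w"
      using norm_triangle_ineq[of "s *\<^sub>R v" "t *\<^sub>R w"] that by simp
    also have "\<dots> \<le> r * norm v + r * norm w"
      using that by (intro add_mono mult_right_mono) auto
    also have "\<dots> \<le> r * (norm v + norm w + 1)"
      using r by (simp add: algebra_simps)
    also have "\<dots> < d" using d(1) n by (simp add: r_def divide_simps)
    finally show ?thesis .
  qed
  obtain s t where st: "0 < s" "s < r" "0 < t" "t < r"
    "f (z + r *\<^sub>R v + r *\<^sub>R w) - f (z + r *\<^sub>R v) - f (z + r *\<^sub>R w) + f z = r\<^sup>2 * F (z + s *\<^sub>R v + t *\<^sub>R w)"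
    using second_difference_mvt[OF assms(2) r, of z v w] near d(2) unfolding F_def by blast
  \<comment> \<open>The second difference does not change when \<open>v\<close> and \<open>w\<close>
    are exchanged, so it also equals \<open>r\<^sup>2\<close> times a value of the other mixed
    derivative in the same parallelogram.\<close>
  have near': "dist (z + s *\<^sub>R w + t *\<^sub>R v) z < d" if "0 \<le> s" "s \<le> r" "0 \<le> t" "t \<le> r" for s t
    using near[OF that(3,4,1,2)] by (simp add: algebra_simps)
  obtain s' t' where st': "0 < s'" "s' < r" "0 < t'" "t' < r"
    "f (z + r *\<^sub>R w + r *\<^sub>R v) - f (z + r *\<^sub>R w) - f (z + r *\<^sub>R v) + f z = r\<^sup>2 * G (z + s' *\<^sub>R w + t' *\<^sub>R v)"
    using second_difference_mvt[OF assms(2) r, of z w v] near' d(2) unfolding G_def by blast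
  have "r\<^sup>2 * F (z + s *\<^sub>R v + t *\<^sub>R w) = r\<^sup>2 * G (z + s' *\<^sub>R w + t' *\<^sub>R v)"
    unfolding st(5)[symmetric] st'(5)[symmetric] by (simp add: algebra_simps)
  then have "F (z + s *\<^sub>R v + t *\<^sub>R w) = G (z + s' *\<^sub>R w + t' *\<^sub>R v)"
    using r by simp
  moreover have "\<bar>F (z + s *\<^sub>R v + t *\<^sub>R w) - F z\<bar> < \<epsilon>"
    using d(2)[OF near] st by simp
  moreover have "\<bar>G (z + s' *\<^sub>R w + t' *\<^sub>R v) - G z\<bar> < \<epsilon>"
    using d(2)[OF near'] st' by simp
  ultimately show False unfolding \<epsilon>_def by (simp add: abs_if split: if_splits)
qed

section \<open>Families of bilinear forms\<close>

lemma bilinear_expand_Basis: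
  fixes B :: "'a::euclidean_space \<Rightarrow> 'b::euclidean_space \<Rightarrow> real"
  assumes "bilinear B"
  shows "B u w = (\<Sum>a\<in>Basis. \<Sum>b\<in>Basis. (u \<bullet> a) * (w \<bullet> b) * B a b)"
proof -
  have l: "linear (\<lambda>u. B u w)" "\<And>a. linear (B a)" using assms by (auto simp: bilinear_def)
  have "B u w = (\<Sum>a\<in>Basis. (u \<bullet> a) *\<^sub>R B a w)"
    using linear_expand_Basis[OF l(1)] .
  also have "\<dots> = (\<Sum>a\<in>Basis. (u \<bullet> a) *\<^sub>R (\<Sum>b\<in>Basis. (w \<bullet> b) *\<^sub>R B a b))"
    using linear_expand_Basis[OF l(2), of _ w] by simp
  finally show ?thesis by (simp add: sum_distrib_left algebra_simps)
qed

text \<open>Product rule in three factors. Differentiability of \<open>G\<close> is known only for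
  fixed arguments \<open>a\<close> and \<open>b\<close>, so the form is expanded in
  \<open>Basis\<close> around \<open>z\<close>; this is why bilinearity is assumed on all of
  \<open>S\<close>.\<close>

lemma has_derivative_bilinear_family:
  fixes G :: "'c::euclidean_space \<Rightarrow> 'a::euclidean_space \<Rightarrow> 'b::euclidean_space \<Rightarrow> real"
  assumes S: "open S" "z \<in> S" and bil: "\<And>z. z \<in> S \<Longrightarrow> bilinear (G z)"
    and G: "\<And>a b. (\<lambda>z. G z a b) differentiable (at z)"
    and u: "(u has_derivative u') (at z)" and w: "(w has_derivative w') (at z)"
  shows "((\<lambda>z. G z (u z) (w z)) has_derivative
    (\<lambda>v. fd (\<lambda>y. G y (u z) (w z)) z v + G z (u' v) (w z) + G z (u z) (w' v))) (at z)"
proof -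
  have *: "((\<lambda>z. G z (u z) (w z)) has_derivative
    (\<lambda>v. (\<Sum>a\<in>Basis. \<Sum>b\<in>Basis. (u z \<bullet> a) * (w z \<bullet> b) * fd (\<lambda>y. G y a b) z v) +
       G z (u' v) (w z) + G z (u z) (w' v))) (at z)"
    if u: "(u has_derivative u') (at z)" and w: "(w has_derivative w') (at z)" for u w u' w'
  proof -
    have 1: "((\<lambda>z. (u z \<bullet> a) * (w z \<bullet> b) * G z a b) has_derivative
      (\<lambda>v. (u z \<bullet> a) * (w z \<bullet> b) * fd (\<lambda>y. G y a b) z v + ((u z \<bullet> a) * (w' v \<bullet> b) + (u' v \<bullet> a) * (w z \<bullet> b)) * G z a b)) (at z)"
      for a b
      by (intro has_derivative_mult has_derivative_inner_left u w fd_has_derivative G)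
    have "((\<lambda>z. \<Sum>a\<in>Basis. \<Sum>b\<in>Basis. (u z \<bullet> a) * (w z \<bullet> b) * G z a b) has_derivative
      (\<lambda>v. \<Sum>a\<in>Basis. \<Sum>b\<in>Basis. (u z \<bullet> a) * (w z \<bullet> b) * fd (\<lambda>y. G y a b) z v +
         ((u z \<bullet> a) * (w' v \<bullet> b) + (u' v \<bullet> a) * (w z \<bullet> b)) * G z a b)) (at z)"
      by (intro has_derivative_sum 1)
    moreover have "(\<Sum>a\<in>Basis. \<Sum>b\<in>Basis. (u z \<bullet> a) * (w z \<bullet> b) * fd (\<lambda>y. G y a b) z v +
         ((u z \<bullet> a) * (w' v \<bullet> b) + (u' v \<bullet> a) * (w z \<bullet> b)) * G z a b) =
       (\<Sum>a\<in>Basis. \<Sum>b\<in>Basis. (u z \<bullet> a) * (w z \<bullet> b) * fd (\<lambda>y. G y a b) z v) +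
       G z (u' v) (w z) + G z (u z) (w' v)" for v
      unfolding bilinear_expand_Basis[OF bil[OF S(2)], of "u' v" "w z"]
        bilinear_expand_Basis[OF bil[OF S(2)], of "u z" "w' v"]
      by (simp add: sum.distrib algebra_simps)
    ultimately have "((\<lambda>z. \<Sum>a\<in>Basis. \<Sum>b\<in>Basis. (u z \<bullet> a) * (w z \<bullet> b) * G z a b) has_derivative
      (\<lambda>v. (\<Sum>a\<in>Basis. \<Sum>b\<in>Basis. (u z \<bullet> a) * (w z \<bullet> b) * fd (\<lambda>y. G y a b) z v) +
         G z (u' v) (w z) + G z (u z) (w' v))) (at z)"
      by simp
    then show ?thesis
      by (rule has_derivative_transform_within_open[OF _ S])
        (simp add: bilinear_expand_Basis[OF bil, symmetric])
  qed
  \<comment> \<open>The formula just shown, applied to constant \<open>u\<close> and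
    \<open>w\<close>, identifies the sum over \<open>Basis\<close> as the derivative with frozen
    arguments.\<close>
  have "fd (\<lambda>y. G y (u z) (w z)) z v =
    (\<Sum>a\<in>Basis. \<Sum>b\<in>Basis. (u z \<bullet> a) * (w z \<bullet> b) * fd (\<lambda>y. G y a b) z v)" for v
    using fd_eqI[OF *[of "\<lambda>_. u z" "\<lambda>_. 0" "\<lambda>_. w z" "\<lambda>_. 0"]] bil[OF S(2)]
    by (simp add: bilinear_lzero bilinear_rzero)
  then show ?thesis using *[OF u w] by simp
qed

lemma smooth_on_bilinear_family:
  fixes G :: "'c::euclidean_space \<Rightarrow> 'a::euclidean_space \<Rightarrow> 'b::euclidean_space \<Rightarrow> real"
  assumes S: "open S" and bil: "\<And>z. z \<in> S \<Longrightarrow> bilinear (G z)"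
    and G: "\<And>a b. smooth_on S (\<lambda>z. G z a b)" and u: "smooth_on S u" and w: "smooth_on S w"
  shows "smooth_on S (\<lambda>z. G z (u z) (w z))"
proof -
  have "smooth_on S (\<lambda>z. \<Sum>a\<in>Basis. \<Sum>b\<in>Basis. (u z \<bullet> a) * (w z \<bullet> b) * G z a b)"
    by (intro smooth_on_sum smooth_on_mult S G smooth_on_linear_compose[OF bounded_linear_inner_left] u w)
  then show ?thesis
    by (rule smooth_on_transform[OF _ S bilinear_expand_Basis[OF bil]])
qed

section \<open>Calculus in a chart\<close>

text \<open>Only charts and their compatibility are kept, so that \<open>tangent_atlas\<close>,
  which is not maximal, is an instance as well.\<close>

locale smooth_atlas =
  fixes A :: "('m, 'e::euclidean_space) atlas"
  assumes charts: "c \<in> A \<Longrightarrow> is_chart c"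
    and compat: "c \<in> A \<Longrightarrow> d \<in> A \<Longrightarrow> compatible c d"
begin

lemma inj_chart: "(U, x) \<in> A \<Longrightarrow> inj_on x U"
  using charts by (auto simp: is_chart_def)

lemma manifold_open_chart:
  assumes "(U, x) \<in> A"
  shows "manifold_open A U"
  unfolding manifold_open_def
proof (intro conjI ballI)
  show "U \<subseteq> points A" using assms by (auto simp: points_def)
  fix c assume "c \<in> A"
  then show "case c of (V, y) \<Rightarrow> open (y ` (V \<inter> U))"
    using compat[OF _ assms, of c] by (cases c) (auto simp: compatible_def)
qed

lemma manifold_open_Int: "manifold_open A V \<Longrightarrow> manifold_open A W \<Longrightarrow> manifold_open A (V \<inter> W)"
  using istopology_manifold_open[of A] charts unfolding istopology_def by blast

lemma smooth_transition:
  assumes "(U, x) \<in> A" "(V, y) \<in> A"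
  shows "smooth_on (y ` (U \<inter> V)) (\<lambda>z. x (inv_into V y z))"
  using compat[OF assms] by (auto simp: compatible_def o_def)

lemma smooth_fun_subset: "smooth_fun A W f \<Longrightarrow> W' \<subseteq> W \<Longrightarrow> smooth_fun A W' f"
  unfolding smooth_fun_def by (fast intro: smooth_on_subset)

end

locale atlas_chart = smooth_atlas A for A :: "('m, 'e::euclidean_space) atlas" +
  fixes U :: "'m set" and x :: "'m \<Rightarrow> 'e"
  assumes chart_mem: "(U, x) \<in> A"
begin

abbreviation ix :: "'e \<Rightarrow> 'm" where "ix \<equiv> inv_into U x"

abbreviation E :: "'e \<Rightarrow> 'm vfield" where "E \<equiv> coord_vector A (U, x)"

lemma ix_x [simp]: "p \<in> U \<Longrightarrow> ix (x p) = p"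
  using inj_chart[OF chart_mem] by simp

lemma x_ix [simp]: "z \<in> x ` U \<Longrightarrow> x (ix z) = z"
  by (rule f_inv_into_f)

lemma ix_mem [simp]: "z \<in> x ` U \<Longrightarrow> ix z \<in> U"
  by (rule inv_into_into)

lemma open_image: "manifold_open A W \<Longrightarrow> W \<subseteq> U \<Longrightarrow> open (x ` W)"
  using chart_mem by (force simp: manifold_open_def Int_absorb1)

lemma open_U: "manifold_open A U"
  using manifold_open_chart[OF chart_mem] .

lemma open_xU: "open (x ` U)"
  using open_image[OF open_U] by simp

lemma manifold_openI:
  assumes W: "W \<subseteq> U" "open (x ` W)"
  shows "manifold_open A W"
  unfolding manifold_open_def
proof (intro conjI ballI)
  show "W \<subseteq> points A" using W chart_mem by (auto simp: points_def)
  fix c assume cA: "c \<in> A"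
  obtain V y where c: "c = (V, y)" by (cases c)
  have inj: "inj_on y V" "inj_on x U" using inj_chart chart_mem cA c by auto
  have "open (y ` (V \<inter> U))" using manifold_open_chart[OF chart_mem] cA c by (auto simp: manifold_open_def)
  moreover have "continuous_on (y ` (V \<inter> U)) (\<lambda>z. x (inv_into V y z))"
    using smooth_on_continuous[OF smooth_transition[OF chart_mem, of V y]] cA c
    by (simp only: Int_commute[of V U])
  ultimately have "open ((\<lambda>z. x (inv_into V y z)) -` (x ` W) \<inter> y ` (V \<inter> U))"
    using continuous_on_open_vimage W(2) by blast
  moreover have "(\<lambda>z. x (inv_into V y z)) -` (x ` W) \<inter> y ` (V \<inter> U) = y ` (V \<inter> W)"
  proof (intro set_eqI iffI)
    fix z assume z: "z \<in> (\<lambda>z. x (inv_into V y z)) -` (x ` W) \<inter> y ` (V \<inter> U)"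
    then obtain p w where p: "z = y p" "p \<in> V" "p \<in> U" "w \<in> W" "x p = x w" using inj(1) by auto
    then have "p = w" using inj_onD[OF inj(2) p(5)] W(1) by auto
    then show "z \<in> y ` (V \<inter> W)" using p by auto
  next
    fix z assume "z \<in> y ` (V \<inter> W)"
    then show "z \<in> (\<lambda>z. x (inv_into V y z)) -` (x ` W) \<inter> y ` (V \<inter> U)"
      using inj(1) W(1) by auto
  qed
  ultimately show "case c of (V, y) \<Rightarrow> open (y ` (V \<inter> W))" using c by simp
qed

text \<open>Inside \<open>U\<close> one chart decides: its expression is carried to every other
  chart by composition with a smooth transition map.\<close>

lemma smooth_fun_chart:
  assumes W: "manifold_open A W" "W \<subseteq> U"
  shows "smooth_fun A W f \<longleftrightarrow> smooth_on (x ` W) (\<lambda>z. f (ix z))"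
proof
  assume "smooth_fun A W f"
  then show "smooth_on (x ` W) (\<lambda>z. f (ix z))"
    using chart_mem W(2) by (auto simp: smooth_fun_def o_def Int_absorb1)
next
  assume f: "smooth_on (x ` W) (\<lambda>z. f (ix z))"
  show "smooth_fun A W f"
    unfolding smooth_fun_def
  proof clarify
    fix V y assume V: "(V, y) \<in> A"
    have inj: "inj_on y V" using inj_chart V by auto
    have op: "open (y ` (V \<inter> W))" using W(1) V by (auto simp: manifold_open_def)
    have sub: "(\<lambda>z. x (inv_into V y z)) ` y ` (V \<inter> W) \<subseteq> x ` W"
      using inj by auto
    have "smooth_on (y ` (V \<inter> W)) (\<lambda>z. x (inv_into V y z))"
      using W(2) by (intro smooth_on_subset[OF smooth_transition[OF chart_mem V]]) auto
    from smooth_on_compose[OF op sub f this]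
    have "smooth_on (y ` (V \<inter> W)) (\<lambda>z. f (ix (x (inv_into V y z))))" .
    moreover have "(f \<circ> inv_into V y) z = f (ix (x (inv_into V y z)))" if "z \<in> y ` (V \<inter> W)" for z
      using that inj W(2) by auto
    ultimately show "smooth_on (y ` (V \<inter> W)) (f \<circ> inv_into V y)"
      using smooth_on_transform[OF _ op] by blast
  qed
qed

lemma smooth_nearE:
  assumes "smooth_near A p f" "p \<in> U"
  obtains W where "manifold_open A W" "p \<in> W" "W \<subseteq> U" "smooth_on (x ` W) (\<lambda>z. f (ix z))"
proof -
  obtain W where W: "manifold_open A W" "p \<in> W" "smooth_fun A W f"
    using assms by (auto simp: smooth_near_def)
  have W': "manifold_open A (W \<inter> U)" using manifold_open_Int[OF W(1) open_U] .
  have "smooth_on (x ` (W \<inter> U)) (\<lambda>z. f (ix z))"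
    using smooth_fun_subset[OF W(3), of "W \<inter> U"] smooth_fun_chart[OF W'] by simp
  then show ?thesis using that[OF W'] W(2) assms(2) by auto
qed

lemma smooth_nearI:
  assumes "manifold_open A W" "p \<in> W" "W \<subseteq> U" "smooth_on (x ` W) (\<lambda>z. f (ix z))"
  shows "smooth_near A p f"
  using assms smooth_fun_chart[OF assms(1,3)] by (auto simp: smooth_near_def)

lemma smooth_near_differentiable:
  assumes "smooth_near A p f" "p \<in> U"
  shows "(\<lambda>z. f (ix z)) differentiable (at (x p))"
  using smooth_nearE[OF assms] smooth_on_differentiable by (metis imageI)

section \<open>Tangent vectors and vector fields in a chart\<close>

lemma coord_vector_apply: "smooth_near A p f \<Longrightarrow> E \<xi> p f = fd (\<lambda>z. f (ix z)) (x p) \<xi>"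
  by (simp add: coord_vector_def chart_deriv_def o_def)

lemma coord_vector_not_smooth: "\<not> smooth_near A p f \<Longrightarrow> E \<xi> p f = 0"
  by (simp add: coord_vector_def)

lemma coord_vector_add: "p \<in> U \<Longrightarrow> E (\<xi> + \<eta>) p = E \<xi> p + E \<eta> p"
  using linear_add[OF linear_frechet_derivative[OF smooth_near_differentiable]]
  by (auto simp: fun_eq_iff coord_vector_def chart_deriv_def o_def)

lemma coord_vector_scale: "p \<in> U \<Longrightarrow> E (a *\<^sub>R \<xi>) p = (\<lambda>f. a * E \<xi> p f)"
  using linear_scale[OF linear_frechet_derivative[OF smooth_near_differentiable]]
  by (auto simp: fun_eq_iff coord_vector_def chart_deriv_def o_def)

lemma coord_vector_minus: "p \<in> U \<Longrightarrow> E (- \<xi>) p = - E \<xi> p"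
  using coord_vector_scale[of p "-1" \<xi>] by (auto simp: fun_eq_iff)

lemma coord_vector_zero: "p \<in> U \<Longrightarrow> E 0 p = 0"
  using coord_vector_scale[of p 0 0] by (auto simp: fun_eq_iff)

text \<open>The chain rule through the transition map from \<open>y\<close> to \<open>x\<close>. On
  functions that are not smooth near \<open>p\<close> both sides have the default value 0.\<close>

lemma coord_vector_change:
  assumes V: "(V, y) \<in> A" and p: "p \<in> U" "p \<in> V"
  shows "coord_vector A (V, y) \<eta> p = E (fd (\<lambda>z. x (inv_into V y z)) (y p) \<eta>) p"
proof
  fix f
  interpret V: atlas_chart A V y by unfold_locales (fact V)
  show "coord_vector A (V, y) \<eta> p f = E (fd (\<lambda>z. x (inv_into V y z)) (y p) \<eta>) p f"
  proof (cases "smooth_near A p f")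
    case True
    have p': "y p \<in> y ` (U \<inter> V)" using p by auto
    have op: "open (y ` (U \<inter> V))"
      using V.open_image[OF manifold_open_Int[OF open_U V.open_U]] by simp
    have t: "((\<lambda>z. x (inv_into V y z)) has_derivative fd (\<lambda>z. x (inv_into V y z)) (y p)) (at (y p))"
      using smooth_on_has_derivative[OF smooth_transition[OF chart_mem V] p'] .
    have f: "((\<lambda>z. f (ix z)) has_derivative fd (\<lambda>z. f (ix z)) (x p)) (at (x (inv_into V y (y p))))"
      using fd_has_derivative[OF smooth_near_differentiable[OF True p(1)]] p by simp
    have "((\<lambda>z. f (ix (x (inv_into V y z)))) has_derivative
        (\<lambda>v. fd (\<lambda>z. f (ix z)) (x p) (fd (\<lambda>z. x (inv_into V y z)) (y p) v))) (at (y p))"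
      using has_derivative_compose[OF t f] .
    then have "((\<lambda>z. f (inv_into V y z)) has_derivative
        (\<lambda>v. fd (\<lambda>z. f (ix z)) (x p) (fd (\<lambda>z. x (inv_into V y z)) (y p) v))) (at (y p))"
      by (rule has_derivative_transform_within_open[OF _ op p']) auto
    then show ?thesis
      using True by (simp add: coord_vector_apply V.coord_vector_apply fd_eqI)
  qed (simp add: coord_vector_not_smooth V.coord_vector_not_smooth)
qed

text \<open>The definition collects vectors from all charts; by the change of components, those of a
  single chart already exhaust the tangent space.\<close>

lemma tangent_space_chart:
  assumes p: "p \<in> U"
  shows "tangent_space A p = range (\<lambda>\<xi>. E \<xi> p)"
proof (intro equalityI subsetI)
  fix v assume "v \<in> tangent_space A p"
  then obtain V y \<eta> where "(V, y) \<in> A" "p \<in> V" "v = coord_vector A (V, y) \<eta> p"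
    unfolding tangent_space_def by force
  then show "v \<in> range (\<lambda>\<xi>. E \<xi> p)" using coord_vector_change[OF _ p] by blast
next
  fix v assume "v \<in> range (\<lambda>\<xi>. E \<xi> p)"
  then show "v \<in> tangent_space A p" using p chart_mem unfolding tangent_space_def by force
qed

lemma coord_vector_mem: "p \<in> U \<Longrightarrow> E \<xi> p \<in> tangent_space A p"
  by (simp add: tangent_space_chart)

lemma smooth_coordinate:
  assumes "bounded_linear L"
  shows "smooth_fun A U (\<lambda>q. L (x q))"
  using smooth_fun_chart[OF open_U] smooth_on_cong[OF open_xU, of "\<lambda>z. L (x (ix z))" L] smooth_on_linear[OF assms]
  by simp

lemma smooth_near_coordinate: "bounded_linear L \<Longrightarrow> p \<in> U \<Longrightarrow> smooth_near A p (\<lambda>q. L (x q))"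
  using smooth_coordinate open_U by (auto simp: smooth_near_def)

lemma coord_vector_coordinate:
  assumes "bounded_linear L" "p \<in> U"
  shows "E \<xi> p (\<lambda>q. L (x q)) = L \<xi>"
proof -
  have "fd (\<lambda>z. L (x (ix z))) (x p) = fd L (x p)"
    using assms by (intro fd_cong_open[OF open_xU]) auto
  also have "\<dots> = L" using fd_eqI[OF bounded_linear_imp_has_derivative[OF assms(1)]] .
  finally show ?thesis
    using coord_vector_apply[OF smooth_near_coordinate[OF assms]] by simp
qed

text \<open>Applying \<open>v\<close> to a coordinate function yields the corresponding component,
  so this inverts \<open>\<lambda>\<xi>. E \<xi> p\<close> on the tangent space at every
  \<open>p\<close> of \<open>U\<close>.\<close>

definition coords :: "'m tvec \<Rightarrow> 'e" where
  "coords v = (\<Sum>b\<in>Basis. v (\<lambda>q. x q \<bullet> b) *\<^sub>R b)"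

lemma coords_coord_vector [simp]: "p \<in> U \<Longrightarrow> coords (E \<xi> p) = \<xi>"
  by (simp add: coords_def coord_vector_coordinate[OF bounded_linear_inner_left] euclidean_representation)

lemma coord_vector_coords: "p \<in> U \<Longrightarrow> v \<in> tangent_space A p \<Longrightarrow> E (coords v) p = v"
  by (auto simp: tangent_space_chart)

lemma coord_vector_inject: "p \<in> U \<Longrightarrow> E \<xi> p = E \<eta> p \<longleftrightarrow> \<xi> = \<eta>"
  using coords_coord_vector by metis

lemma smooth_near_smooth_on:
  assumes "manifold_open A W" "W \<subseteq> U" "smooth_on (x ` W) (\<lambda>z. f (ix z))" "q \<in> W"
  shows "smooth_near A q f"
  using assms by (intro smooth_nearI)

lemma ix_image:
  assumes "W \<subseteq> U" "z \<in> x ` W"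
  shows "ix z \<in> W" "x (ix z) = z"
  using assms by auto

lemma coord_vector_smooth_apply:
  assumes W: "manifold_open A W" "W \<subseteq> U" and f: "smooth_on (x ` W) (\<lambda>z. f (ix z))" and z: "z \<in> x ` W"
  shows "E \<xi> (ix z) f = fd (\<lambda>z. f (ix z)) z \<xi>"
  using coord_vector_apply[OF smooth_near_smooth_on[OF W f]] ix_image[OF W(2) z] by simp

lemma smooth_on_coord_vector:
  assumes W: "manifold_open A W" "W \<subseteq> U" and f: "smooth_on (x ` W) (\<lambda>z. f (ix z))"
    and \<xi>: "smooth_on (x ` W) \<xi>"
  shows "smooth_on (x ` W) (\<lambda>z. fd (\<lambda>z. f (ix z)) z (\<xi> z))"
  using smooth_on_fd_apply[OF open_image[OF W] f smooth_on_linear[OF bounded_linear_ident] \<xi>] by simp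

text \<open>The components are the values of \<open>X\<close> on the coordinate functions, hence
  smooth. Conversely, \<open>X\<close> acts as a derivative in a smoothly varying direction.\<close>

lemma smooth_field_chart:
  assumes W: "manifold_open A W" "W \<subseteq> U"
  shows "smooth_field A W X \<longleftrightarrow> (\<exists>\<xi>. smooth_on (x ` W) \<xi> \<and> (\<forall>p\<in>W. X p = E (\<xi> (x p)) p))"
proof
  assume X: "smooth_field A W X"
  define \<xi> where "\<xi> = (\<lambda>z. coords (X (ix z)))"
  have "smooth_on (x ` W) (\<lambda>z. \<xi> z \<bullet> b)" if b: "b \<in> Basis" for b
  proof -
    have "smooth_fun A W (\<lambda>q. x q \<bullet> b)"
      using smooth_fun_subset[OF smooth_coordinate[OF bounded_linear_inner_left] W(2)] .
    then have "smooth_fun A W (\<lambda>p. X p (\<lambda>q. x q \<bullet> b))"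
      using X W(1) by (auto simp: smooth_field_def)
    then have "smooth_on (x ` W) (\<lambda>z. X (ix z) (\<lambda>q. x q \<bullet> b))"
      using smooth_fun_chart[OF W] by simp
    moreover have "\<xi> z \<bullet> b = X (ix z) (\<lambda>q. x q \<bullet> b)" for z
      using b by (simp add: \<xi>_def coords_def)
    ultimately show ?thesis by simp
  qed
  then have "smooth_on (x ` W) \<xi>" by (rule smooth_on_components[OF open_image[OF W]])
  moreover have "X p = E (\<xi> (x p)) p" if "p \<in> W" for p
    using that W(2) X by (auto simp: \<xi>_def smooth_field_def coord_vector_coords subset_iff)
  ultimately show "\<exists>\<xi>. smooth_on (x ` W) \<xi> \<and> (\<forall>p\<in>W. X p = E (\<xi> (x p)) p)" by blast
next
  assume "\<exists>\<xi>. smooth_on (x ` W) \<xi> \<and> (\<forall>p\<in>W. X p = E (\<xi> (x p)) p)"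
  then obtain \<xi> where \<xi>: "smooth_on (x ` W) \<xi>" "\<And>p. p \<in> W \<Longrightarrow> X p = E (\<xi> (x p)) p" by blast
  show "smooth_field A W X"
    unfolding smooth_field_def
  proof (intro conjI allI impI ballI)
    show "X p \<in> tangent_space A p" if "p \<in> W" for p
      using that W(2) \<xi>(2) by (auto simp: coord_vector_mem)
    fix V f assume V: "manifold_open A V \<and> V \<subseteq> W \<and> smooth_fun A V f"
    then have V': "manifold_open A V" "V \<subseteq> U" and f: "smooth_on (x ` V) (\<lambda>z. f (ix z))"
      using W(2) smooth_fun_chart[of V] by auto
    have "X (ix z) f = fd (\<lambda>z. f (ix z)) z (\<xi> z)" if z: "z \<in> x ` V" for z
    proof -
      have "ix z \<in> W" "x (ix z) = z" using ix_image[OF V'(2) z] V by auto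
      then show ?thesis
        using \<xi>(2) coord_vector_smooth_apply[OF V' f z] by simp
    qed
    moreover have "smooth_on (x ` V) (\<lambda>z. fd (\<lambda>z. f (ix z)) z (\<xi> z))"
      using V by (intro smooth_on_coord_vector V' f smooth_on_subset[OF \<xi>(1)]) auto
    ultimately show "smooth_fun A V (\<lambda>p. X p f)"
      using smooth_fun_chart[OF V'] smooth_on_transform[OF _ open_image[OF V'], of "\<lambda>z. fd (\<lambda>z. f (ix z)) z (\<xi> z)"]
      by simp
  qed
qed

lemma smooth_field_coord_vector:
  "manifold_open A W \<Longrightarrow> W \<subseteq> U \<Longrightarrow> smooth_on (x ` W) \<xi> \<Longrightarrow> smooth_field A W (\<lambda>p. E (\<xi> (x p)) p)"
  using smooth_field_chart by blast

lemma smooth_field_const: "manifold_open A W \<Longrightarrow> W \<subseteq> U \<Longrightarrow> smooth_field A W (E \<xi>)"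
  by (rule smooth_field_coord_vector[OF _ _ smooth_on_const])

text \<open>Each iterated derivative of \<open>f\<close> splits into a first-order part, where the
  components of the inner field are differentiated, and a second-order part, which is symmetric in
  the two fields and cancels.\<close>

lemma lie_bracket_chart:
  assumes W: "manifold_open A W" "W \<subseteq> U" and p: "p \<in> W"
    and \<xi>: "smooth_on (x ` W) \<xi>" "\<And>p. p \<in> W \<Longrightarrow> X p = E (\<xi> (x p)) p"
    and \<eta>: "smooth_on (x ` W) \<eta>" "\<And>p. p \<in> W \<Longrightarrow> Y p = E (\<eta> (x p)) p"
  shows "lie_bracket A X Y p = E (fd \<eta> (x p) (\<xi> (x p)) - fd \<xi> (x p) (\<eta> (x p))) p"
proof
  fix f
  show "lie_bracket A X Y p f = E (fd \<eta> (x p) (\<xi> (x p)) - fd \<xi> (x p) (\<eta> (x p))) p f"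
  proof (cases "smooth_near A p f")
    case True
    have pU: "p \<in> U" using p W(2) by auto
    obtain W1 where W1: "manifold_open A W1" "p \<in> W1" "W1 \<subseteq> U" "smooth_on (x ` W1) (\<lambda>z. f (ix z))"
      using smooth_nearE[OF True pU] .
    define V where "V = W \<inter> W1"
    have V: "manifold_open A V" "V \<subseteq> U" "p \<in> V" "V \<subseteq> W"
      using manifold_open_Int[OF W(1) W1(1)] W(2) p W1(2) by (auto simp: V_def)
    have op: "open (x ` V)" using open_image[OF V(1,2)] .
    have xp: "x p \<in> x ` V" using V(3) by simp
    define F where "F = (\<lambda>z. f (ix z))"
    have F: "smooth_on (x ` V) F"
      unfolding F_def V_def by (rule smooth_on_subset[OF W1(4) image_mono[OF Int_lower2]])
    have sV: "smooth_on (x ` V) \<zeta>" if "smooth_on (x ` W) \<zeta>" for \<zeta> :: "'e \<Rightarrow> 'e"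
      by (rule smooth_on_subset[OF that image_mono[OF V(4)]])
    note \<xi>V = sV[OF \<xi>(1)] and \<eta>V = sV[OF \<eta>(1)]
    \<comment> \<open>Stated for arbitrary fields because it is used for both orders of
      differentiation.\<close>
    have outer: "Z p (\<lambda>q. Y q f) = fd (\<lambda>z. fd F z (\<eta> z)) (x p) (\<zeta> (x p)) \<and>
        fd (\<lambda>z. fd F z (\<eta> z)) (x p) (\<zeta> (x p)) = fd F (x p) (fd \<eta> (x p) (\<zeta> (x p))) +
          (\<Sum>a\<in>Basis. \<Sum>b\<in>Basis. (\<eta> (x p) \<bullet> b) * (\<zeta> (x p) \<bullet> a) * fd (\<lambda>z. fd F z b) (x p) a)"
      if \<zeta>: "smooth_on (x ` V) \<zeta>" "\<And>p. p \<in> W \<Longrightarrow> Z p = E (\<zeta> (x p)) p"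
        and \<eta>: "smooth_on (x ` V) \<eta>" "\<And>p. p \<in> W \<Longrightarrow> Y p = E (\<eta> (x p)) p" for Y Z \<eta> \<zeta>
    proof
      have Yf: "Y (ix z) f = fd F z (\<eta> z)" if z: "z \<in> x ` V" for z
      proof -
        have "ix z \<in> W" "x (ix z) = z" using ix_image[OF V(2) z] V(4) by auto
        then show ?thesis
          using \<eta>(2) coord_vector_smooth_apply[OF V(1,2) F[unfolded F_def] z] by (simp add: F_def)
      qed
      have "smooth_on (x ` V) (\<lambda>z. fd F z (\<eta> z))"
        using smooth_on_coord_vector[OF V(1,2) F[unfolded F_def] \<eta>(1)] by (simp add: F_def)
      then have sm: "smooth_on (x ` V) (\<lambda>z. Y (ix z) f)"
        by (rule smooth_on_transform[OF _ op Yf])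
      have "Z p (\<lambda>q. Y q f) = fd (\<lambda>z. Y (ix z) f) (x p) (\<zeta> (x p))"
        using \<zeta>(2) p coord_vector_smooth_apply[OF V(1,2) sm xp] pU by simp
      also have "\<dots> = fd (\<lambda>z. fd F z (\<eta> z)) (x p) (\<zeta> (x p))"
        using fd_cong_open[OF op xp Yf] by simp
      finally show "Z p (\<lambda>q. Y q f) = fd (\<lambda>z. fd F z (\<eta> z)) (x p) (\<zeta> (x p))" .
      have lin: "linear (fd F z)" if "z \<in> x ` V" for z
        using smooth_on_differentiable[OF F that] by (rule linear_frechet_derivative)
      have "((\<lambda>z. \<Sum>b\<in>Basis. (\<eta> z \<bullet> b) * fd F z b) has_derivative
          (\<lambda>v. \<Sum>b\<in>Basis. (\<eta> (x p) \<bullet> b) * fd (\<lambda>z. fd F z b) (x p) v + (fd \<eta> (x p) v \<bullet> b) * fd F (x p) b)) (at (x p))"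
        by (intro has_derivative_sum has_derivative_mult has_derivative_inner_left
            smooth_on_has_derivative[OF \<eta>(1) xp] smooth_on_has_derivative[OF smooth_on_fd[OF F] xp])
      then have "((\<lambda>z. fd F z (\<eta> z)) has_derivative
          (\<lambda>v. \<Sum>b\<in>Basis. (\<eta> (x p) \<bullet> b) * fd (\<lambda>z. fd F z b) (x p) v + (fd \<eta> (x p) v \<bullet> b) * fd F (x p) b)) (at (x p))"
        by (rule has_derivative_transform_within_open[OF _ op xp])
          (simp add: linear_expand_Basis[OF lin, symmetric, simplified])
      then have "fd (\<lambda>z. fd F z (\<eta> z)) (x p) (\<zeta> (x p)) =
          (\<Sum>b\<in>Basis. (fd \<eta> (x p) (\<zeta> (x p)) \<bullet> b) * fd F (x p) b) +
          (\<Sum>b\<in>Basis. (\<eta> (x p) \<bullet> b) * fd (\<lambda>z. fd F z b) (x p) (\<zeta> (x p)))"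
        by (simp add: fd_eqI sum.distrib)
      also have "(\<Sum>b\<in>Basis. (fd \<eta> (x p) (\<zeta> (x p)) \<bullet> b) * fd F (x p) b) = fd F (x p) (fd \<eta> (x p) (\<zeta> (x p)))"
        by (simp add: linear_expand_Basis[OF lin[OF xp], symmetric, simplified])
      also have "(\<Sum>b\<in>Basis. (\<eta> (x p) \<bullet> b) * fd (\<lambda>z. fd F z b) (x p) (\<zeta> (x p))) =
          (\<Sum>b\<in>Basis. \<Sum>a\<in>Basis. (\<eta> (x p) \<bullet> b) * (\<zeta> (x p) \<bullet> a) * fd (\<lambda>z. fd F z b) (x p) a)"
      proof (rule sum.cong[OF refl])
        fix b :: 'e
        have "linear (fd (\<lambda>z. fd F z b) (x p))"
          using smooth_on_differentiable[OF smooth_on_fd[OF F] xp] by (rule linear_frechet_derivative)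
        from linear_expand_Basis[OF this, of "\<zeta> (x p)"]
        show "(\<eta> (x p) \<bullet> b) * fd (\<lambda>z. fd F z b) (x p) (\<zeta> (x p)) =
          (\<Sum>a\<in>Basis. (\<eta> (x p) \<bullet> b) * (\<zeta> (x p) \<bullet> a) * fd (\<lambda>z. fd F z b) (x p) a)"
          by (simp add: sum_distrib_left mult.assoc)
      qed
      also have "\<dots> = (\<Sum>a\<in>Basis. \<Sum>b\<in>Basis. (\<eta> (x p) \<bullet> b) * (\<zeta> (x p) \<bullet> a) * fd (\<lambda>z. fd F z b) (x p) a)"
        by (rule sum.swap)
      finally show "fd (\<lambda>z. fd F z (\<eta> z)) (x p) (\<zeta> (x p)) = fd F (x p) (fd \<eta> (x p) (\<zeta> (x p))) +
          (\<Sum>a\<in>Basis. \<Sum>b\<in>Basis. (\<eta> (x p) \<bullet> b) * (\<zeta> (x p) \<bullet> a) * fd (\<lambda>z. fd F z b) (x p) a)" .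
    qed
    \<comment> \<open>Exchanging the sums and the two differentiations shows that the second-order
      parts agree.\<close>
    have "(\<Sum>a\<in>Basis. \<Sum>b\<in>Basis. (\<eta> (x p) \<bullet> b) * (\<xi> (x p) \<bullet> a) * fd (\<lambda>z. fd F z b) (x p) a) =
        (\<Sum>b\<in>Basis. \<Sum>a\<in>Basis. (\<eta> (x p) \<bullet> b) * (\<xi> (x p) \<bullet> a) * fd (\<lambda>z. fd F z b) (x p) a)"
      by (rule sum.swap)
    also have "\<dots> = (\<Sum>b\<in>Basis. \<Sum>a\<in>Basis. (\<xi> (x p) \<bullet> a) * (\<eta> (x p) \<bullet> b) * fd (\<lambda>z. fd F z a) (x p) b)"
      by (intro sum.cong refl) (simp add: fd_commute[OF op F xp] mult.commute)
    finally have symm: "(\<Sum>a\<in>Basis. \<Sum>b\<in>Basis. (\<eta> (x p) \<bullet> b) * (\<xi> (x p) \<bullet> a) * fd (\<lambda>z. fd F z b) (x p) a) =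
        (\<Sum>a\<in>Basis. \<Sum>b\<in>Basis. (\<xi> (x p) \<bullet> b) * (\<eta> (x p) \<bullet> a) * fd (\<lambda>z. fd F z b) (x p) a)" .
    have lin: "linear (fd F (x p))"
      using smooth_on_differentiable[OF F xp] by (rule linear_frechet_derivative)
    have "lie_bracket A X Y p f = fd F (x p) (fd \<eta> (x p) (\<xi> (x p))) - fd F (x p) (fd \<xi> (x p) (\<eta> (x p)))"
      using outer[OF \<xi>V \<xi>(2) \<eta>V \<eta>(2)] outer[OF \<eta>V \<eta>(2) \<xi>V \<xi>(2)] True symm
      by (simp add: lie_bracket_def)
    also have "\<dots> = fd F (x p) (fd \<eta> (x p) (\<xi> (x p)) - fd \<xi> (x p) (\<eta> (x p)))"
      by (simp add: linear_diff[OF lin])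
    finally show ?thesis using coord_vector_apply[OF True] by (simp add: F_def)
  next
    case False
    then show ?thesis by (simp add: lie_bracket_def coord_vector_not_smooth)
  qed
qed

text \<open>The derivatives of \<open>\<eta>\<close> and \<open>\<zeta>\<close> given by the product
  rule cancel against those in the brackets. What remains involves only the values of the two fields
  at the point: the Lie derivative is a tensor.\<close>

lemma lie_derivative_chart:
  assumes W: "manifold_open A W" "W \<subseteq> U" and p: "p \<in> W"
    and G: "\<And>q a b. q \<in> U \<Longrightarrow> g q (E a q) (E b q) = G (x q) a b"
    and bil: "\<And>z. z \<in> x ` U \<Longrightarrow> bilinear (G z)"
    and smooth_G: "\<And>a b. smooth_on (x ` U) (\<lambda>z. G z a b)"
    and \<xi>: "smooth_on (x ` W) \<xi>" "\<And>p. p \<in> W \<Longrightarrow> X p = E (\<xi> (x p)) p"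
    and \<eta>: "smooth_on (x ` W) \<eta>" "\<And>p. p \<in> W \<Longrightarrow> Y p = E (\<eta> (x p)) p"
    and \<zeta>: "smooth_on (x ` W) \<zeta>" "\<And>p. p \<in> W \<Longrightarrow> Z p = E (\<zeta> (x p)) p"
  shows "lie_derivative A X g Y Z p =
    fd (\<lambda>z. G z (\<eta> (x p)) (\<zeta> (x p))) (x p) (\<xi> (x p)) +
    G (x p) (fd \<xi> (x p) (\<eta> (x p))) (\<zeta> (x p)) + G (x p) (\<eta> (x p)) (fd \<xi> (x p) (\<zeta> (x p)))"
proof -
  have op: "open (x ` W)" using open_image[OF W] .
  have pU: "p \<in> U" and xp: "x p \<in> x ` W" and xpU: "x p \<in> x ` U" using p W(2) by auto
  have sub: "x ` W \<subseteq> x ` U" using W(2) by auto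
  have bilW: "bilinear (G z)" if "z \<in> x ` W" for z using bil sub that by auto
  have gz: "g (ix z) (Y (ix z)) (Z (ix z)) = G z (\<eta> z) (\<zeta> z)" if "z \<in> x ` W" for z
    using ix_image[OF W(2) that] \<eta>(2) \<zeta>(2) G[of "ix z"] W(2) by auto
  have "smooth_on (x ` W) (\<lambda>z. G z (\<eta> z) (\<zeta> z))"
    using smooth_on_bilinear_family[OF op bilW smooth_on_subset[OF smooth_G sub] \<eta>(1) \<zeta>(1)] .
  then have sm: "smooth_on (x ` W) (\<lambda>z. g (ix z) (Y (ix z)) (Z (ix z)))"
    by (rule smooth_on_transform[OF _ op gz])
  have "X p (\<lambda>q. g q (Y q) (Z q)) = fd (\<lambda>z. g (ix z) (Y (ix z)) (Z (ix z))) (x p) (\<xi> (x p))"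
    using \<xi>(2)[OF p] coord_vector_smooth_apply[OF W sm xp] pU by simp
  also have "\<dots> = fd (\<lambda>z. G z (\<eta> z) (\<zeta> z)) (x p) (\<xi> (x p))"
    using fd_cong_open[OF op xp gz] by simp
  also have "\<dots> = fd (\<lambda>z. G z (\<eta> (x p)) (\<zeta> (x p))) (x p) (\<xi> (x p)) +
      G (x p) (fd \<eta> (x p) (\<xi> (x p))) (\<zeta> (x p)) + G (x p) (\<eta> (x p)) (fd \<zeta> (x p) (\<xi> (x p)))"
    using fd_eqI[OF has_derivative_bilinear_family[OF op xp bilW smooth_on_differentiable[OF smooth_G xpU]
      smooth_on_has_derivative[OF \<eta>(1) xp] smooth_on_has_derivative[OF \<zeta>(1) xp]]] by simp
  finally have 1: "X p (\<lambda>q. g q (Y q) (Z q)) = fd (\<lambda>z. G z (\<eta> (x p)) (\<zeta> (x p))) (x p) (\<xi> (x p)) +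
      G (x p) (fd \<eta> (x p) (\<xi> (x p))) (\<zeta> (x p)) + G (x p) (\<eta> (x p)) (fd \<zeta> (x p) (\<xi> (x p)))" .
  have 2: "lie_bracket A X Y p = E (fd \<eta> (x p) (\<xi> (x p)) - fd \<xi> (x p) (\<eta> (x p))) p"
    by (rule lie_bracket_chart[OF W p \<xi>(1) _ \<eta>(1)]) (simp_all add: \<xi>(2) \<eta>(2))
  have 3: "lie_bracket A X Z p = E (fd \<zeta> (x p) (\<xi> (x p)) - fd \<xi> (x p) (\<zeta> (x p))) p"
    by (rule lie_bracket_chart[OF W p \<xi>(1) _ \<zeta>(1)]) (simp_all add: \<xi>(2) \<zeta>(2))
  show ?thesis
    unfolding lie_derivative_def 1 2 3
    by (simp add: \<eta>(2) \<zeta>(2) p G pU bilinear_lsub[OF bil[OF xpU]] bilinear_rsub[OF bil[OF xpU]])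
qed

end

section \<open>Connections and metrics in a chart\<close>

lemma
  assumes conn: "affine_connection A nabla" and W: "manifold_open A W"
    and X: "smooth_field A W X" and Y: "smooth_field A W Y"
  shows connection_smooth: "smooth_field A W (nabla X Y)"
    and connection_local: "(\<And>q. q \<in> W \<Longrightarrow> X' q = X q) \<Longrightarrow> (\<And>q. q \<in> W \<Longrightarrow> Y' q = Y q) \<Longrightarrow> p \<in> W \<Longrightarrow>
      nabla X' Y' p = nabla X Y p"
    and connection_add_left: "smooth_field A W Z \<Longrightarrow> p \<in> W \<Longrightarrow> nabla (X + Z) Y p = nabla X Y p + nabla Z Y p"
    and connection_add_right: "smooth_field A W Z \<Longrightarrow> p \<in> W \<Longrightarrow> nabla X (Y + Z) p = nabla X Y p + nabla X Z p"
    and connection_mult_left: "smooth_fun A W f \<Longrightarrow> p \<in> W \<Longrightarrow>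
      nabla (\<lambda>q \<phi>. f q * X q \<phi>) Y p = (\<lambda>\<phi>. f p * nabla X Y p \<phi>)"
    and connection_mult_right: "smooth_fun A W f \<Longrightarrow> p \<in> W \<Longrightarrow>
      nabla X (\<lambda>q \<phi>. f q * Y q \<phi>) p = (\<lambda>\<phi>. X p f * Y p \<phi> + f p * nabla X Y p \<phi>)"
proof -
  note * = conn[unfolded affine_connection_def, THEN spec, THEN spec, THEN spec, THEN mp,
    OF conjI[OF W conjI[OF X Y]]]
  note loc = *[THEN conjunct2, THEN conjunct1, THEN spec, THEN spec, THEN mp]
  note add = *[THEN conjunct2, THEN conjunct2, THEN conjunct1, THEN spec, THEN mp]
  note mul = *[THEN conjunct2, THEN conjunct2, THEN conjunct2, THEN spec, THEN mp]
  show "smooth_field A W (nabla X Y)" using * by (rule conjunct1)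
  show "nabla X' Y' p = nabla X Y p"
    if "\<And>q. q \<in> W \<Longrightarrow> X' q = X q" "\<And>q. q \<in> W \<Longrightarrow> Y' q = Y q" "p \<in> W"
  proof -
    have "\<forall>p\<in>W. X' p = X p \<and> Y' p = Y p" using that(1,2) by blast
    from bspec[OF loc[OF this] that(3)] show ?thesis .
  qed
  show "nabla (X + Z) Y p = nabla X Y p + nabla Z Y p" if "smooth_field A W Z" "p \<in> W"
    by (rule conjunct1[OF bspec[OF add[OF that(1)] that(2)]])
  show "nabla X (Y + Z) p = nabla X Y p + nabla X Z p" if "smooth_field A W Z" "p \<in> W"
    by (rule conjunct2[OF bspec[OF add[OF that(1)] that(2)]])
  show "nabla (\<lambda>q \<phi>. f q * X q \<phi>) Y p = (\<lambda>\<phi>. f p * nabla X Y p \<phi>)" if "smooth_fun A W f" "p \<in> W"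
    by (rule conjunct1[OF bspec[OF mul[OF that(1)] that(2)]])
  show "nabla X (\<lambda>q \<phi>. f q * Y q \<phi>) p = (\<lambda>\<phi>. X p f * Y p \<phi> + f p * nabla X Y p \<phi>)"
    if "smooth_fun A W f" "p \<in> W"
    by (rule conjunct2[OF bspec[OF mul[OF that(1)] that(2)]])
qed

lemma dual_connectionsD:
  assumes "dual_connections A h nabla nabla'" "manifold_open A W"
    "smooth_field A W X" "smooth_field A W Y" "smooth_field A W Z" "p \<in> W"
  shows "X p (\<lambda>q. h q (Y q) (Z q)) = h p (nabla X Y p) (Z p) + h p (Y p) (nabla' X Z p)"
  using assms by (simp add: dual_connections_def)

lemma riemannian_metric_smooth:
  assumes "riemannian_metric A h" "manifold_open A W" "smooth_field A W X" "smooth_field A W Y"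
  shows "smooth_fun A W (\<lambda>p. h p (X p) (Y p))"
  using assms by (simp add: riemannian_metric_def)

context atlas_chart
begin

lemma connection_mem:
  assumes "affine_connection A nabla" "p \<in> U"
  shows "nabla (E c) (E a) p \<in> tangent_space A p"
proof -
  have "smooth_field A U (nabla (E c) (E a))"
    by (intro connection_smooth[OF assms(1)] open_U smooth_field_const subset_refl)
  then show ?thesis using assms(2) by (simp add: smooth_field_def)
qed

lemma smooth_fun_const: "smooth_fun A U (\<lambda>_. r)"
  using smooth_fun_chart[OF open_U] smooth_on_const by simp

lemma coord_vector_const:
  assumes "p \<in> U"
  shows "E c p (\<lambda>_. r) = 0"
  using assms smooth_fun_const open_U by (subst coord_vector_apply) (auto simp: smooth_near_def)

text \<open>Constant combinations of coordinate fields agree with the coordinate field of the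
  combination only on \<open>U\<close>, so locality precedes each use of additivity or of the
  product rules. In the second argument the Leibniz term vanishes because the factor is
  constant.\<close>

lemma connection_bilinear:
  assumes conn: "affine_connection A nabla" and p: "p \<in> U"
  shows "bilinear (\<lambda>c a. coords (nabla (E c) (E a) p))"
proof -
  note sm = smooth_field_const[OF open_U subset_refl]
  let ?n = "\<lambda>c a. coords (nabla (E c) (E a) p)"
  have rep: "nabla (E c) (E a) p = E (?n c a) p" for c a
    using coord_vector_coords[OF p connection_mem[OF conn p]] by simp
  note loc = connection_local[OF conn open_U _ _ _ _ p]
    and add = connection_add_left[OF conn open_U _ _ _ p] connection_add_right[OF conn open_U _ _ _ p]
    and mul = connection_mult_left[OF conn open_U _ _ smooth_fun_const p]
      connection_mult_right[OF conn open_U _ _ smooth_fun_const p]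
  have E_add: "E (c + d) q = (E c + E d) q" if "q \<in> U" for c d q
    using coord_vector_add[OF that] by simp
  have sm_add: "smooth_field A U (E c + E d)" for c d
    using sm[of "c + d"] E_add unfolding smooth_field_chart[OF open_U subset_refl] by simp
  have sm_scale: "smooth_field A U (\<lambda>q \<phi>. r * E c q \<phi>)" for c r
    using sm[of "r *\<^sub>R c"] coord_vector_scale unfolding smooth_field_chart[OF open_U subset_refl] by simp
  have "?n (c + d) a = ?n c a + ?n d a" for c d a
  proof -
    have "nabla (E (c + d)) (E a) p = nabla (E c + E d) (E a) p"
      by (rule loc[OF sm_add sm E_add refl])
    also have "\<dots> = E (?n c a + ?n d a) p"
      using rep[of c a] rep[of d a] by (simp add: add(1)[OF sm sm sm] coord_vector_add[OF p])
    finally show ?thesis using p by simp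
  qed
  moreover have "?n (r *\<^sub>R c) a = r *\<^sub>R ?n c a" for r c a
  proof -
    have "nabla (E (r *\<^sub>R c)) (E a) p = nabla (\<lambda>q \<phi>. r * E c q \<phi>) (E a) p"
      by (rule loc[OF sm_scale sm coord_vector_scale refl])
    also have "\<dots> = E (r *\<^sub>R ?n c a) p"
      using rep[of c a] by (simp add: mul(1)[OF sm sm] coord_vector_scale[OF p])
    finally show ?thesis using p by simp
  qed
  moreover have "?n a (c + d) = ?n a c + ?n a d" for c d a
  proof -
    have "nabla (E a) (E (c + d)) p = nabla (E a) (E c + E d) p"
      by (rule loc[OF sm sm_add refl E_add])
    also have "\<dots> = E (?n a c + ?n a d) p"
      using rep[of a c] rep[of a d] by (simp add: add(2)[OF sm sm sm] coord_vector_add[OF p])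
    finally show ?thesis using p by simp
  qed
  moreover have "?n a (r *\<^sub>R c) = r *\<^sub>R ?n a c" for r c a
  proof -
    have "nabla (E a) (E (r *\<^sub>R c)) p = nabla (E a) (\<lambda>q \<phi>. r * E c q \<phi>) p"
      by (rule loc[OF sm sm_scale refl coord_vector_scale])
    also have "\<dots> = E (r *\<^sub>R ?n a c) p"
      using rep[of a c] by (simp add: mul(2)[OF sm sm] coord_vector_scale[OF p] coord_vector_const[OF p])
    finally show ?thesis using p by simp
  qed
  ultimately show ?thesis by (simp add: bilinear_def linear_iff)
qed

text \<open>Fields with constant components have zero bracket, so only the antisymmetric part of
  \<open>nabla\<close> remains in the torsion.\<close>

lemma connection_symmetric:
  assumes conn: "affine_connection A nabla" and tor: "torsion_free A nabla" and p: "p \<in> U"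
  shows "nabla (E c) (E a) p = nabla (E a) (E c) p"
proof -
  note sm = smooth_field_const[OF open_U subset_refl]
  have "lie_bracket A (E c) (E a) p = E (fd (\<lambda>_. a) (x p) c - fd (\<lambda>_. c) (x p) a) p"
    by (rule lie_bracket_chart[OF open_U subset_refl p]) (simp_all add: smooth_on_const)
  then have "lie_bracket A (E c) (E a) p = 0" using p by (simp add: coord_vector_zero)
  moreover have "torsion A nabla (E c) (E a) p = 0"
    using tor sm open_U p unfolding torsion_free_def by blast
  ultimately show ?thesis by (simp add: torsion_def)
qed

text \<open>The coefficient of \<open>\<beta>\<close> vanishes at \<open>p\<close> and has
  derivative 1 along \<open>c\<close>. Hence the Leibniz rule leaves exactly
  \<open>E \<beta> p\<close>, and the other terms die by \<open>flat\<close> or by the zero at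
  \<open>p\<close>. Such fields are the sections on which the connector is evaluated.\<close>

lemma connection_affine_field:
  assumes conn: "affine_connection A nabla" and flat: "\<And>c a. nabla (E c) (E a) p = 0" and p: "p \<in> U"
    and c: "c \<noteq> 0"
  shows "nabla (E c) (\<lambda>q. E (\<eta> + (((x q - x p) \<bullet> c) / (c \<bullet> c)) *\<^sub>R \<beta>) q) p = E \<beta> p"
proof -
  note sm = smooth_field_const[OF open_U subset_refl]
  define y where "y = (\<lambda>z. ((z - x p) \<bullet> c) / (c \<bullet> c))"
  define f where "f = (\<lambda>q. y (x q))"
  have y': "(y has_derivative (\<lambda>v. (v \<bullet> c) / (c \<bullet> c))) (at z)" for z
    unfolding y_def by (auto intro!: derivative_eq_intros simp: c)
  have y: "smooth_on S y" for S
  proof -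
    have "y = (\<lambda>z. z \<bullet> (c /\<^sub>R (c \<bullet> c)) + - (x p \<bullet> c) / (c \<bullet> c))"
      by (simp add: y_def fun_eq_iff inner_diff_left divide_inverse algebra_simps)
    moreover have "smooth_on UNIV (\<lambda>z. z \<bullet> (c /\<^sub>R (c \<bullet> c)) + - (x p \<bullet> c) / (c \<bullet> c))"
      by (intro smooth_on_add smooth_on_const smooth_on_linear[OF bounded_linear_inner_left] open_UNIV)
    ultimately show ?thesis using smooth_on_subset by (metis subset_UNIV)
  qed
  have fs: "smooth_on (x ` U) (\<lambda>z. f (ix z))"
    by (rule smooth_on_transform[OF y open_xU]) (simp add: f_def)
  then have f: "smooth_fun A U f" using smooth_fun_chart[OF open_U] by simp
  have fp: "f p = 0" by (simp add: f_def y_def)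
  have xp: "x p \<in> x ` U" using p by simp
  have "E c p f = fd (\<lambda>z. f (ix z)) (x p) c"
    using coord_vector_smooth_apply[OF open_U subset_refl fs xp] p by simp
  also have "\<dots> = fd y (x p) c"
    using fd_cong_open[OF open_xU xp, of "\<lambda>z. f (ix z)" y] by (simp add: f_def)
  also have "\<dots> = 1" using fd_eqI[OF y'] c by simp
  finally have cf: "E c p f = 1" .
  have eq: "E (\<eta> + y (x q) *\<^sub>R \<beta>) q = (E \<eta> + (\<lambda>q \<phi>. f q * E \<beta> q \<phi>)) q" if "q \<in> U" for q
    using that by (simp add: coord_vector_add coord_vector_scale f_def)
  have smf: "smooth_field A U (\<lambda>q \<phi>. f q * E \<beta> q \<phi>)"
    unfolding smooth_field_chart[OF open_U subset_refl]
  proof (intro exI conjI ballI)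
    show "smooth_on (x ` U) (\<lambda>z. y z *\<^sub>R \<beta>)"
      by (intro smooth_on_linear_compose[OF bounded_linear_scaleR_left] open_xU y)
  qed (simp add: f_def coord_vector_scale)
  have smsum: "smooth_field A U (E \<eta> + (\<lambda>q \<phi>. f q * E \<beta> q \<phi>))"
    unfolding smooth_field_chart[OF open_U subset_refl]
  proof (intro exI conjI ballI)
    show "smooth_on (x ` U) (\<lambda>z. \<eta> + y z *\<^sub>R \<beta>)"
      by (intro smooth_on_add smooth_on_const smooth_on_linear_compose[OF bounded_linear_scaleR_left] open_xU y)
  qed (simp add: eq)
  have "nabla (E c) (\<lambda>q. E (\<eta> + y (x q) *\<^sub>R \<beta>) q) p = nabla (E c) (E \<eta> + (\<lambda>q \<phi>. f q * E \<beta> q \<phi>)) p"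
    by (rule connection_local[OF conn open_U sm smsum refl eq p])
  also have "\<dots> = nabla (E c) (E \<eta>) p + nabla (E c) (\<lambda>q \<phi>. f q * E \<beta> q \<phi>) p"
    by (rule connection_add_right[OF conn open_U sm sm smf p])
  also have "nabla (E c) (\<lambda>q \<phi>. f q * E \<beta> q \<phi>) p = (\<lambda>\<phi>. E c p f * E \<beta> p \<phi> + f p * nabla (E c) (E \<beta>) p \<phi>)"
    by (rule connection_mult_right[OF conn open_U sm sm f p])
  finally show ?thesis by (simp add: flat cf fp y_def)
qed

section \<open>The metric in a chart and its first derivatives\<close>

definition metric :: "('m \<Rightarrow> 'm tvec \<Rightarrow> 'm tvec \<Rightarrow> real) \<Rightarrow> 'e \<Rightarrow> 'e \<Rightarrow> 'e \<Rightarrow> real" where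
  "metric h z a b = h (ix z) (E a (ix z)) (E b (ix z))"

lemma metric_x: "p \<in> U \<Longrightarrow> h p (E a p) (E b p) = metric h (x p) a b"
  by (simp add: metric_def)

lemma U_points: "U \<subseteq> points A"
  using open_U by (simp add: manifold_open_def)

lemma metric_sym:
  assumes "riemannian_metric A h" "z \<in> x ` U"
  shows "metric h z a b = metric h z b a"
  using assms U_points coord_vector_mem ix_mem unfolding riemannian_metric_def metric_def by blast

lemma metric_fd_commute:
  assumes h: "riemannian_metric A h" and z: "z \<in> x ` U"
  shows "fd (\<lambda>z. metric h z a b) z c = fd (\<lambda>z. metric h z b a) z c"
proof -
  have "fd (\<lambda>z. metric h z a b) z = fd (\<lambda>z. metric h z b a) z"
    by (rule fd_cong_open[OF open_xU z]) (rule metric_sym[OF h])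
  then show ?thesis by simp
qed

lemma metric_bilinear:
  assumes h: "riemannian_metric A h" and z: "z \<in> x ` U"
  shows "bilinear (metric h z)"
proof -
  have ixz: "ix z \<in> U" using z by simp
  have add: "metric h z (a + b) c = metric h z a c + metric h z b c" for a b c
    using h U_points coord_vector_mem[OF ixz] ixz
    unfolding riemannian_metric_def metric_def coord_vector_add[OF ixz] by blast
  have scale: "metric h z (r *\<^sub>R a) c = r * metric h z a c" for r a c
    using h U_points coord_vector_mem[OF ixz] ixz
    unfolding riemannian_metric_def metric_def coord_vector_scale[OF ixz] by blast
  show ?thesis
    using add scale metric_sym[OF h z] by (simp add: bilinear_def linear_iff)
qed

lemma metric_pos:
  assumes h: "riemannian_metric A h" and z: "z \<in> x ` U" and a: "a \<noteq> 0"
  shows "metric h z a a > 0"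
proof -
  have ixz: "ix z \<in> U" using z by simp
  have "E a (ix z) \<noteq> 0" using coord_vector_inject[OF ixz, of a 0] a by (simp add: coord_vector_zero ixz)
  then show ?thesis
    using h U_points coord_vector_mem[OF ixz] ixz unfolding riemannian_metric_def metric_def by blast
qed

lemma metric_smooth:
  assumes h: "riemannian_metric A h"
  shows "smooth_on (x ` U) (\<lambda>z. metric h z a b)"
proof -
  have "smooth_fun A U (\<lambda>p. h p (E a p) (E b p))"
    by (intro riemannian_metric_smooth[OF h] open_U smooth_field_const subset_refl)
  then show ?thesis using smooth_fun_chart[OF open_U] by (simp add: metric_def)
qed

lemma metric_dual:
  assumes h: "riemannian_metric A h" and dual: "dual_connections A h nabla nabla'" and p: "p \<in> U"
  shows "fd (\<lambda>z. metric h z a b) (x p) c =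
    metric h (x p) (coords (nabla (E c) (E a) p)) b + metric h (x p) a (coords (nabla' (E c) (E b) p))"
proof -
  have conn: "affine_connection A nabla" "affine_connection A nabla'"
    using dual by (auto simp: dual_connections_def)
  have xp: "x p \<in> x ` U" using p by simp
  have "E c p (\<lambda>q. h q (E a q) (E b q)) = h p (nabla (E c) (E a) p) (E b p) + h p (E a p) (nabla' (E c) (E b) p)"
    using smooth_field_const[OF open_U subset_refl] by (intro dual_connectionsD[OF dual open_U _ _ _ p])
  moreover have "E c p (\<lambda>q. h q (E a q) (E b q)) = fd (\<lambda>z. metric h z a b) (x p) c"
    using coord_vector_smooth_apply[OF open_U subset_refl metric_smooth[OF h, unfolded metric_def] xp] p
    by (simp add: metric_def)
  moreover have "h p (nabla (E c) (E a) p) (E b p) = metric h (x p) (coords (nabla (E c) (E a) p)) b"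
    using coord_vector_coords[OF p connection_mem[OF conn(1) p], of c a] p by (simp add: metric_def)
  moreover have "h p (E a p) (nabla' (E c) (E b) p) = metric h (x p) a (coords (nabla' (E c) (E b) p))"
    using coord_vector_coords[OF p connection_mem[OF conn(2) p], of c b] p by (simp add: metric_def)
  ultimately show ?thesis by simp
qed

text \<open>By \<open>flat\<close>, only the term with \<open>nabla'\<close> survives in
  \<open>metric_dual\<close>, and it is symmetric in \<open>b\<close> and \<open>c\<close>. Together
  with the symmetry of the metric this makes the derivative symmetric in all three slots.\<close>

lemma metric_fd_symmetric:
  assumes h: "riemannian_metric A h" and dual: "dual_connections A h nabla nabla'"
    and tor: "torsion_free A nabla'" and flat: "\<And>c a. nabla (E c) (E a) p = 0" and p: "p \<in> U"
  shows "fd (\<lambda>z. metric h z a b) (x p) c = fd (\<lambda>z. metric h z a c) (x p) b"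
proof -
  have xp: "x p \<in> x ` U" using p by simp
  have conn: "affine_connection A nabla'" using dual by (auto simp: dual_connections_def)
  have [simp]: "coords 0 = 0" by (simp add: coords_def)
  show "fd (\<lambda>z. metric h z a b) (x p) c = fd (\<lambda>z. metric h z a c) (x p) b"
    using connection_symmetric[OF conn tor p, of b c] bilinear_lzero[OF metric_bilinear[OF h xp]]
    by (simp add: metric_dual[OF h dual p] flat)
qed

text \<open>Koszul's formula gives twice the left-hand contraction as a sum of two derivatives of
  the metric minus a third. The hypothesis \<open>sym\<close> makes all three equal, so a single one
  remains.\<close>

lemma levi_civita_symmetric_fd:
  assumes h: "riemannian_metric A h" and lc: "levi_civita A h D" and p: "p \<in> U"
    and sym: "\<And>a b c. fd (\<lambda>z. metric h z a b) (x p) c = fd (\<lambda>z. metric h z a c) (x p) b"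
  shows "2 * metric h (x p) (coords (D (E a) (E b) p)) c = fd (\<lambda>z. metric h z b c) (x p) a"
proof -
  have xp: "x p \<in> x ` U" using p by simp
  have dual: "dual_connections A h D D" and tor: "torsion_free A D" using lc by (auto simp: levi_civita_def)
  have conn: "affine_connection A D" using dual by (auto simp: dual_connections_def)
  define C where "C a b c = metric h (x p) (coords (D (E a) (E b) p)) c" for a b c
  have C: "fd (\<lambda>z. metric h z a b) (x p) c = C c a b + C c b a" for a b c
    using metric_dual[OF h dual p, of a b c] metric_sym[OF h xp] by (simp add: C_def)
  have C': "C a b c = C b a c" for a b c
    using connection_symmetric[OF conn tor p] by (simp add: C_def)
  show ?thesis
    using C[of b c a] C[of b a c] C[of c a b] C'[of a b c] C'[of a c b] C'[of b c a]
      sym[of b c a] sym[of c a b] sym[of a b c] metric_fd_commute[OF h xp, of c b a]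
      metric_fd_commute[OF h xp, of a c b] metric_fd_commute[OF h xp, of a b c]
    unfolding C_def[symmetric] by linarith
qed

end

section \<open>The tangent bundle and the connector\<close>

locale bundle_chart = atlas_chart A U x
  for A :: "('m, real ^ 'n) atlas" and U :: "'m set" and x :: "'m \<Rightarrow> real ^ 'n"
begin

definition tx :: "'m tbundle \<Rightarrow> (real ^ 'n) \<times> (real ^ 'n)" where
  "tx = (\<lambda>(p, v). (x p, \<chi> i. v (\<lambda>q. x q $ i)))"

lemma tangent_chart_eq: "tangent_chart A (U, x) = (bundle_over A U, tx)"
  by (simp add: tangent_chart_def tx_def)

lemma coord_vector_nth: "p \<in> U \<Longrightarrow> E \<xi> p (\<lambda>q. x q $ i) = \<xi> $ i"
  using coord_vector_coordinate[OF bounded_linear_vec_nth] .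

lemma tx_coord_vector [simp]: "p \<in> U \<Longrightarrow> tx (p, E \<xi> p) = (x p, \<xi>)"
  by (simp add: tx_def coord_vector_nth)

lemma bundle_over_iff:
  assumes "W \<subseteq> U"
  shows "u \<in> bundle_over A W \<longleftrightarrow> (\<exists>p\<in>W. \<exists>\<xi>. u = (p, E \<xi> p))"
proof (cases u)
  case (Pair p v)
  show ?thesis
  proof (cases "p \<in> W")
    case True
    then have "p \<in> U" using assms by blast
    then show ?thesis using Pair True by (auto simp: bundle_over_def tangent_space_chart)
  qed (simp add: Pair bundle_over_def)
qed

lemma bundle_over_mem [simp]: "p \<in> U \<Longrightarrow> (p, E \<xi> p) \<in> bundle_over A U"
  using bundle_over_iff by blast

lemma tx_image:
  assumes W: "W \<subseteq> U"
  shows "tx ` bundle_over A W = (x ` W) \<times> UNIV"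
proof (intro equalityI subsetI)
  fix z assume "z \<in> tx ` bundle_over A W"
  then obtain p \<xi> where "p \<in> W" "z = tx (p, E \<xi> p)" unfolding image_iff Bex_def bundle_over_iff[OF W] by blast
  moreover from this have "p \<in> U" using W by blast
  ultimately show "z \<in> (x ` W) \<times> UNIV" by simp
next
  fix z assume "z \<in> (x ` W) \<times> (UNIV :: (real ^ 'n) set)"
  then obtain p \<xi> where p: "p \<in> W" "z = (x p, \<xi>)" by auto
  moreover from p(1) have "p \<in> U" using W by blast
  ultimately have "z = tx (p, E \<xi> p)" by simp
  moreover have "(p, E \<xi> p) \<in> bundle_over A W" using p bundle_over_iff[OF W] by blast
  ultimately show "z \<in> tx ` bundle_over A W" by blast
qed

lemma inj_tx: "inj_on tx (bundle_over A U)"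
proof (rule inj_onI)
  fix u v assume "u \<in> bundle_over A U" "v \<in> bundle_over A U" and eq: "tx u = tx v"
  then obtain p q \<xi> \<eta> where u: "u = (p, E \<xi> p)" "p \<in> U" and v: "v = (q, E \<eta> q)" "q \<in> U"
    unfolding bundle_over_iff[OF subset_refl] by blast
  then have "x p = x q" "\<xi> = \<eta>" using eq by simp_all
  then have "p = q" using inj_onD[OF inj_chart[OF chart_mem]] u(2) v(2) by blast
  then show "u = v" using u v \<open>\<xi> = \<eta>\<close> by simp
qed

lemma inv_tx:
  assumes "z \<in> x ` U"
  shows "inv_into (bundle_over A U) tx (z, \<eta>) = (ix z, E \<eta> (ix z))"
proof -
  have z: "ix z \<in> U" "x (ix z) = z" using assms by auto
  have "inv_into (bundle_over A U) tx (tx (ix z, E \<eta> (ix z))) = (ix z, E \<eta> (ix z))"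
    using z(1) by (intro inv_into_f_f inj_tx) simp
  then show ?thesis using z by simp
qed

lemma is_chart_tangent: "is_chart (tangent_chart A (U, x))"
  using inj_tx tx_image[OF subset_refl] open_xU
  by (simp add: tangent_chart_eq is_chart_def open_Times)

end

lemma bundle_over_Int: "bundle_over A U \<inter> bundle_over A V = bundle_over A (U \<inter> V)"
  by (auto simp: bundle_over_def)

text \<open>The transition map of \<open>TM\<close> is the pair of the transition map of
  \<open>M\<close> and its differential acting on the fibre coordinate.\<close>

lemma (in bundle_chart) tangent_transition:
  assumes V: "(V, y) \<in> A"
  shows "open (tx ` (bundle_over A V \<inter> bundle_over A U))"
    and "smooth_on (tx ` (bundle_over A V \<inter> bundle_over A U))
      (snd (tangent_chart A (V, y)) \<circ> inv_into (bundle_over A U) tx)"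
proof -
  interpret V: bundle_chart A V y by unfold_locales (fact V)
  have im: "tx ` (bundle_over A V \<inter> bundle_over A U) = x ` (V \<inter> U) \<times> UNIV"
    by (simp add: bundle_over_Int tx_image)
  have op: "open (x ` (V \<inter> U))"
    using open_image[OF manifold_open_Int[OF V.open_U open_U]] by simp
  then show op': "open (tx ` (bundle_over A V \<inter> bundle_over A U))"
    by (simp add: im open_Times)
  let ?t = "\<lambda>z. y (ix z)"
  have t: "smooth_on (x ` (V \<inter> U)) ?t"
    using smooth_transition[OF V chart_mem] .
  have prod_open: "open (x ` (V \<inter> U) \<times> (UNIV :: (real ^ 'n) set))" using op by (simp add: open_Times)
  have "smooth_on (x ` (V \<inter> U) \<times> (UNIV :: (real ^ 'n) set)) (\<lambda>w. (?t (fst w), fd ?t (fst w) (snd w)))"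
  proof (rule smooth_on_Pair[OF prod_open])
    have sub: "fst ` (x ` (V \<inter> U) \<times> (UNIV :: (real ^ 'n) set)) \<subseteq> x ` (V \<inter> U)" by auto
    show "smooth_on (x ` (V \<inter> U) \<times> (UNIV :: (real ^ 'n) set)) (\<lambda>w. ?t (fst w))"
      by (rule smooth_on_compose[OF prod_open sub t smooth_on_linear[OF bounded_linear_fst]])
    show "smooth_on (x ` (V \<inter> U) \<times> (UNIV :: (real ^ 'n) set)) (\<lambda>w. fd ?t (fst w) (snd w))"
      by (rule smooth_on_fd_apply[OF prod_open t smooth_on_linear[OF bounded_linear_fst]
          smooth_on_linear[OF bounded_linear_snd] sub])
  qed
  then have "smooth_on (x ` (V \<inter> U) \<times> (UNIV :: (real ^ 'n) set)) (V.tx \<circ> inv_into (bundle_over A U) tx)"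
  proof (rule smooth_on_transform[OF _ prod_open])
    fix w assume "w \<in> x ` (V \<inter> U) \<times> (UNIV :: (real ^ 'n) set)"
    then obtain p \<eta> where p: "p \<in> V" "p \<in> U" "w = (x p, \<eta>)" by auto
    then have "(V.tx \<circ> inv_into (bundle_over A U) tx) w = V.tx (p, E \<eta> p)"
      by (simp add: inv_tx)
    also have "E \<eta> p = V.E (fd ?t (x p) \<eta>) p"
      using V.coord_vector_change[OF chart_mem p(1,2)] .
    finally show "(V.tx \<circ> inv_into (bundle_over A U) tx) w = (?t (fst w), fd ?t (fst w) (snd w))"
      using p by simp
  qed
  then show "smooth_on (tx ` (bundle_over A V \<inter> bundle_over A U))
      (snd (tangent_chart A (V, y)) \<circ> inv_into (bundle_over A U) tx)"
    by (simp add: im V.tangent_chart_eq)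
qed

lemma smooth_atlas_tangent:
  fixes A :: "('m, real ^ 'n) atlas"
  assumes "smooth_atlas A"
  shows "smooth_atlas (tangent_atlas A)"
proof -
  interpret smooth_atlas A by fact
  show ?thesis
  proof
    fix c assume "c \<in> tangent_atlas A"
    then obtain U x where c: "(U, x) \<in> A" "c = tangent_chart A (U, x)" by (auto simp: tangent_atlas_def)
    interpret bundle_chart A U x by unfold_locales (fact c)
    show "is_chart c" using is_chart_tangent c by simp
    fix d assume "d \<in> tangent_atlas A"
    then obtain V y where d: "(V, y) \<in> A" "d = tangent_chart A (V, y)" by (auto simp: tangent_atlas_def)
    interpret V: bundle_chart A V y by unfold_locales (fact d)
    show "compatible c d"
      using tangent_transition[OF d(1)] V.tangent_transition[OF c(1)]
      by (simp add: c(2) d(2) tangent_chart_eq V.tangent_chart_eq compatible_def Int_commute)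
  qed
qed

text \<open>The calculus in a chart of \<open>M\<close> is thereby available on the bundle over
  \<open>U\<close> under the prefix \<open>TM\<close>; in particular
  \<open>TM.E (\<alpha>, \<beta>)\<close> has base part \<open>\<alpha>\<close> and fibre part
  \<open>\<beta>\<close>.\<close>

sublocale bundle_chart \<subseteq> TM: atlas_chart "tangent_atlas A" "bundle_over A U" tx
proof -
  interpret T: smooth_atlas "tangent_atlas A"
    by (rule smooth_atlas_tangent) unfold_locales
  show "atlas_chart (tangent_atlas A) (bundle_over A U) tx"
  proof
    show "(bundle_over A U, tx) \<in> tangent_atlas A"
      using chart_mem tangent_chart_eq by (force simp: tangent_atlas_def)
  qed
qed

context bundle_chart
begin

section \<open>Differentials of the projection and of sections; the connector\<close>

lemma manifold_open_bundle_over: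
  assumes W: "manifold_open A W" "W \<subseteq> U"
  shows "manifold_open (tangent_atlas A) (bundle_over A W)"
proof (rule TM.manifold_openI)
  show "bundle_over A W \<subseteq> bundle_over A U" using W(2) by (auto simp: bundle_over_def)
  show "open (tx ` bundle_over A W)" using open_image[OF W] by (simp add: tx_image W(2) open_Times)
qed

text \<open>In the charts the projection is \<open>fst\<close>, so its differential forgets
  \<open>\<beta>\<close>. The work lies in showing that \<open>\<phi> \<circ> fst\<close> is smooth
  near the point, since otherwise the vector would take its default value 0 on it.\<close>

lemma push_proj_coord_vector:
  assumes p: "p \<in> U"
  shows "push_proj A (p, E \<eta> p) (TM.E (\<alpha>, \<beta>) (p, E \<eta> p)) = E \<alpha> p"
proof
  fix \<phi>
  let ?u = "(p, E \<eta> p)"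
  show "push_proj A ?u (TM.E (\<alpha>, \<beta>) ?u) \<phi> = E \<alpha> p \<phi>"
  proof (cases "smooth_near A p \<phi>")
    case True
    obtain W where W: "manifold_open A W" "p \<in> W" "W \<subseteq> U" "smooth_on (x ` W) (\<lambda>z. \<phi> (ix z))"
      using smooth_nearE[OF True p] .
    let ?S = "x ` W \<times> (UNIV :: (real ^ 'n) set)"
    have op: "open ?S" using open_image[OF W(1,3)] by (simp add: open_Times)
    have eq: "(\<phi> \<circ> fst) (TM.ix z) = \<phi> (ix (fst z))" if z: "z \<in> ?S" for z
    proof -
      have "fst z \<in> x ` U" using z W(3) by auto
      then have "TM.ix (fst z, snd z) = (ix (fst z), E (snd z) (ix (fst z)))" by (rule inv_tx)
      then show ?thesis by simp
    qed
    have mem: "(x p, \<eta>) \<in> ?S" using W(2) by simp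
    have "smooth_on ?S (\<lambda>z. \<phi> (ix (fst z)))"
      by (rule smooth_on_compose[OF op _ W(4) smooth_on_linear[OF bounded_linear_fst]]) auto
    then have "smooth_on ?S (\<lambda>z. (\<phi> \<circ> fst) (TM.ix z))"
      by (rule smooth_on_transform[OF _ op eq])
    then have sm: "smooth_on (tx ` bundle_over A W) (\<lambda>z. (\<phi> \<circ> fst) (TM.ix z))"
      by (simp add: tx_image[OF W(3)])
    have sub: "bundle_over A W \<subseteq> bundle_over A U" using W(3) by (auto simp: bundle_over_def)
    have "?u \<in> bundle_over A W" using W(2,3) bundle_over_iff[OF W(3)] by blast
    then have near: "smooth_near (tangent_atlas A) ?u (\<phi> \<circ> fst)"
      by (rule TM.smooth_nearI[OF manifold_open_bundle_over[OF W(1,3)] _ sub sm])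
    have d: "((\<lambda>z. \<phi> (ix (fst z))) has_derivative (\<lambda>v. fd (\<lambda>z. \<phi> (ix z)) (x p) (fst v))) (at (x p, \<eta>))"
      using smooth_near_differentiable[OF True p]
      by (intro has_derivative_compose[OF has_derivative_fst[OF has_derivative_ident]])
        (simp add: fd_has_derivative)
    have "push_proj A ?u (TM.E (\<alpha>, \<beta>) ?u) \<phi> = TM.E (\<alpha>, \<beta>) ?u (\<phi> \<circ> fst)"
      using True by (simp add: push_forward_def)
    also have "\<dots> = fd (\<lambda>z. (\<phi> \<circ> fst) (TM.ix z)) (x p, \<eta>) (\<alpha>, \<beta>)"
      using TM.coord_vector_apply[OF near] p by simp
    also have "\<dots> = fd (\<lambda>z. \<phi> (ix (fst z))) (x p, \<eta>) (\<alpha>, \<beta>)"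
      using fd_cong_open[OF op mem eq] by simp
    also have "\<dots> = fd (\<lambda>z. \<phi> (ix z)) (x p) \<alpha>"
      using fd_eqI[OF d] by simp
    finally show ?thesis using coord_vector_apply[OF True] by simp
  next
    case False
    then show ?thesis by (simp add: push_forward_def coord_vector_not_smooth)
  qed
qed

text \<open>In the charts the section is the graph map of \<open>y\<close>, whose differential sends
  \<open>\<alpha>\<close> to \<open>(\<alpha>, fd y (x p) \<alpha>)\<close>.\<close>

lemma push_forward_section:
  assumes p: "p \<in> U" and y: "smooth_on (x ` U) y"
  shows "push_forward (tangent_atlas A) (\<lambda>q. (q, E (y (x q)) q)) p (E \<alpha> p) =
    TM.E (\<alpha>, fd y (x p) \<alpha>) (p, E (y (x p)) p)"
proof
  fix \<phi>
  let ?s = "\<lambda>q. (q, E (y (x q)) q)" and ?u = "(p, E (y (x p)) p)"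
  have xp: "x p \<in> x ` U" using p by simp
  show "push_forward (tangent_atlas A) ?s p (E \<alpha> p) \<phi> = TM.E (\<alpha>, fd y (x p) \<alpha>) ?u \<phi>"
  proof (cases "smooth_near (tangent_atlas A) ?u \<phi>")
    case True
    obtain W where W: "manifold_open (tangent_atlas A) W" "?u \<in> W" "W \<subseteq> bundle_over A U"
      "smooth_on (tx ` W) (\<lambda>z. \<phi> (TM.ix z))"
      using TM.smooth_nearE[OF True bundle_over_mem[OF p]] .
    let ?c = "\<lambda>z. (z, y z)"
    have c: "smooth_on (x ` U) ?c"
      by (rule smooth_on_Pair[OF open_xU smooth_on_linear[OF bounded_linear_ident] y])
    \<comment> \<open>\<open>\<phi>\<close> is smooth only on \<open>W\<close>, which need not
      contain whole fibres; \<open>S\<close> consists of the base points at which the section lies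
      in \<open>W\<close>.\<close>
    define S where "S = ?c -` (tx ` W) \<inter> x ` U"
    have op: "open S"
      unfolding S_def using continuous_on_open_vimage[OF open_xU] smooth_on_continuous[OF c]
        TM.open_image[OF W(1,3)] by blast
    have Su: "S \<subseteq> x ` U" by (auto simp: S_def)
    have xpS: "x p \<in> S" using W(2) p by (force simp: S_def)
    have xS: "x ` (ix ` S) = S" using Su by force
    have ixS: "ix ` S \<subseteq> U" using Su by auto
    have opS: "manifold_open A (ix ` S)" by (rule manifold_openI[OF ixS]) (simp add: xS op)
    have eq: "(\<phi> \<circ> ?s) (ix z) = \<phi> (TM.ix (?c z))" if "z \<in> S" for z
    proof -
      have "z \<in> x ` U" using that Su by auto
      then show ?thesis using inv_tx[of z "y z"] by simp
    qed
    have "smooth_on S (\<lambda>z. \<phi> (TM.ix (?c z)))"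
      by (rule smooth_on_compose[OF op _ W(4) smooth_on_subset[OF c Su]]) (auto simp: S_def)
    then have "smooth_on S (\<lambda>z. (\<phi> \<circ> ?s) (ix z))"
      by (rule smooth_on_transform[OF _ op eq])
    then have sm: "smooth_on (x ` (ix ` S)) (\<lambda>z. (\<phi> \<circ> ?s) (ix z))"
      by (simp only: xS)
    have "p \<in> ix ` S" using xpS p by force
    then have near: "smooth_near A p (\<phi> \<circ> ?s)"
      by (rule smooth_nearI[OF opS _ ixS sm])
    have dc: "(?c has_derivative (\<lambda>v. (v, fd y (x p) v))) (at (x p))"
      by (intro has_derivative_Pair has_derivative_ident smooth_on_has_derivative[OF y xp])
    have df: "((\<lambda>z. \<phi> (TM.ix z)) has_derivative fd (\<lambda>z. \<phi> (TM.ix z)) (?c (x p))) (at (?c (x p)))"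
      using TM.smooth_near_differentiable[OF True bundle_over_mem[OF p]] p by (simp add: fd_has_derivative)
    have d: "((\<lambda>z. \<phi> (TM.ix (?c z))) has_derivative
        (\<lambda>v. fd (\<lambda>z. \<phi> (TM.ix z)) (?c (x p)) (v, fd y (x p) v))) (at (x p))"
      using has_derivative_compose[OF dc df] .
    have "push_forward (tangent_atlas A) ?s p (E \<alpha> p) \<phi> = E \<alpha> p (\<phi> \<circ> ?s)"
      using True by (simp add: push_forward_def)
    also have "\<dots> = fd (\<lambda>z. (\<phi> \<circ> ?s) (ix z)) (x p) \<alpha>"
      using coord_vector_apply[OF near] .
    also have "\<dots> = fd (\<lambda>z. \<phi> (TM.ix (?c z))) (x p) \<alpha>"
      using fd_cong_open[OF op xpS eq] by simp
    also have "\<dots> = fd (\<lambda>z. \<phi> (TM.ix z)) (?c (x p)) (\<alpha>, fd y (x p) \<alpha>)"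
      using fd_eqI[OF d] by simp
    finally show ?thesis using TM.coord_vector_apply[OF True] p by simp
  next
    case False
    then show ?thesis by (simp add: push_forward_def TM.coord_vector_not_smooth)
  qed
qed

lemma connector_section:
  assumes "is_connector A nabla K" "manifold_open A W" "smooth_field A W X" "smooth_field A W Y" "p \<in> W"
  shows "K (p, Y p) (push_forward (tangent_atlas A) (\<lambda>q. (q, Y q)) p (X p)) = nabla X Y p"
  using assms by (simp add: is_connector_def)

text \<open>For \<open>\<alpha> \<noteq> 0\<close> the vector \<open>(\<alpha>, \<beta>)\<close> is \<open>Y\<^sub>* \<alpha>\<close> for a field \<open>Y\<close> affine in the coordinates; vertical vectors
  are differences of two such vectors.\<close>

lemma connector_coord_vector:
  assumes conn: "affine_connection A nabla" and flat: "\<And>c a. nabla (E c) (E a) p = 0"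
    and K: "is_connector A nabla K" and p: "p \<in> U"
  shows "K (p, E \<eta> p) (TM.E (\<alpha>, \<beta>) (p, E \<eta> p)) = E \<beta> p"
proof -
  let ?u = "(p, E \<eta> p)"
  have u: "?u \<in> bundle_over A U" using p by simp
  have up: "?u \<in> bundle_over A (points A)" using u U_points by (auto simp: bundle_over_def)
  have nonzero: "K ?u (TM.E (\<alpha>, \<beta>) ?u) = E \<beta> p" if \<alpha>: "\<alpha> \<noteq> 0" for \<alpha> \<beta>
  proof -
    \<comment> \<open>Chosen to have value \<open>\<eta>\<close> at \<open>x p\<close> and
      derivative \<open>\<beta>\<close> along \<open>\<alpha>\<close>; the normalisation by
      \<open>\<alpha> \<bullet> \<alpha>\<close> is where \<open>\<alpha>\<close> must be
      nonzero.\<close>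
    define y where "y = (\<lambda>z. \<eta> + (((z - x p) \<bullet> \<alpha>) / (\<alpha> \<bullet> \<alpha>)) *\<^sub>R \<beta>)"
    have y': "(y has_derivative (\<lambda>v. ((v \<bullet> \<alpha>) / (\<alpha> \<bullet> \<alpha>)) *\<^sub>R \<beta>)) (at z)" for z
      unfolding y_def by (auto intro!: derivative_eq_intros simp: \<alpha>)
    have y: "smooth_on S y" for S
    proof -
      have "smooth_on UNIV (\<lambda>z. (\<eta> - ((x p \<bullet> \<alpha>) / (\<alpha> \<bullet> \<alpha>)) *\<^sub>R \<beta>) + (z \<bullet> (\<alpha> /\<^sub>R (\<alpha> \<bullet> \<alpha>))) *\<^sub>R \<beta>)"
        by (intro smooth_on_add smooth_on_const open_UNIV smooth_on_linear_compose[OF bounded_linear_scaleR_left]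
            smooth_on_linear[OF bounded_linear_inner_left])
      then have "smooth_on UNIV y"
        by (rule smooth_on_transform[OF _ open_UNIV])
          (simp add: y_def inner_diff_left divide_inverse algebra_simps)
      then show ?thesis by (rule smooth_on_subset) simp
    qed
    have [simp]: "y (x p) = \<eta>" by (simp add: y_def)
    have [simp]: "fd y (x p) \<alpha> = \<beta>" using fd_eqI[OF y'] \<alpha> by simp
    have "K (p, E (y (x p)) p) (push_forward (tangent_atlas A) (\<lambda>q. (q, E (y (x q)) q)) p (E \<alpha> p)) =
        nabla (E \<alpha>) (\<lambda>q. E (y (x q)) q) p"
      by (rule connector_section[OF K open_U smooth_field_const[OF open_U subset_refl]
            smooth_field_coord_vector[OF open_U subset_refl y] p])
    also have "\<dots> = E \<beta> p"
      unfolding y_def by (rule connection_affine_field[OF conn flat p \<alpha>])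
    finally show ?thesis using push_forward_section[OF p y, of \<alpha>] by simp
  qed
  show ?thesis
  proof (cases "\<alpha> = 0")
    case True
    \<comment> \<open>An arbitrary nonzero vector: \<open>(0, \<beta>)\<close> is the sum of
      \<open>(- c, 0)\<close> and \<open>(c, \<beta>)\<close>, and both summands have nonzero base
      part.\<close>
    define c :: "real ^ 'n" where "c = axis undefined 1"
    have c: "c \<noteq> 0" by (simp add: c_def axis_eq_0_iff)
    have "K ?u (TM.E (- c, 0) ?u + TM.E (c, \<beta>) ?u) = K ?u (TM.E (- c, 0) ?u) + K ?u (TM.E (c, \<beta>) ?u)"
      using K up TM.coord_vector_mem[OF u] unfolding is_connector_def by blast
    also have "TM.E (- c, 0) ?u + TM.E (c, \<beta>) ?u = TM.E (\<alpha>, \<beta>) ?u"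
      using TM.coord_vector_add[OF u, of "(- c, 0)" "(c, \<beta>)"] True by simp
    finally show ?thesis using nonzero[of "- c" 0] nonzero[of c \<beta>] c p by (simp add: coord_vector_zero)
  qed (rule nonzero)
qed

end

section \<open>Kaehler functions in affine coordinates\<close>

lemma linear_expand_axis:
  fixes L :: "real ^ 'n \<Rightarrow> 'b::real_vector"
  assumes "linear L"
  shows "L v = (\<Sum>i\<in>UNIV. (v $ i) *\<^sub>R L (axis i 1))"
proof -
  have "L v = L (\<Sum>i\<in>UNIV. (v $ i) *\<^sub>R axis i 1)"
    using basis_expansion[of v] by (simp add: scalar_mult_eq_scaleR)
  then show ?thesis by (simp only: linear_sum[OF assms] linear_scale[OF assms])
qed

text \<open>Cramer's rule writes the solution as quotients of determinants, which are polynomials in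
  the smooth entries.\<close>

lemma smooth_linear_system:
  fixes M :: "'a::euclidean_space \<Rightarrow> real ^ 'n ^ 'n" and w :: "'a \<Rightarrow> real ^ 'n"
  assumes S: "open S" and M: "\<And>i j. smooth_on S (\<lambda>z. M z $ i $ j)" and w: "\<And>i. smooth_on S (\<lambda>z. w z $ i)"
    and det: "\<And>z. z \<in> S \<Longrightarrow> det (M z) \<noteq> 0"
  shows "\<exists>P. smooth_on S P \<and> (\<forall>z\<in>S. M z *v P z = w z)"
proof (intro exI conjI ballI)
  let ?N = "\<lambda>k z. \<chi> i j. if j = k then w z $ i else M z $ i $ j"
  let ?P = "\<lambda>z. \<chi> k. det (?N k z) / det (M z)"
  have smooth_det: "smooth_on S (\<lambda>z. det (N z))"
    if "\<And>i j. smooth_on S (\<lambda>z. N z $ i $ j)" for N :: "'a \<Rightarrow> real ^ 'n ^ 'n"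
    unfolding det_def by (intro smooth_on_sum smooth_on_mult smooth_on_const smooth_on_prod S that)
  have N: "smooth_on S (\<lambda>z. ?N k z $ i $ j)" for k i j
    using w M by (cases "j = k") simp_all
  show "M z *v ?P z = w z" if "z \<in> S" for z
    using cramer[OF det[OF that]] by blast
  show "smooth_on S ?P"
  proof (rule smooth_on_components[OF S])
    fix b :: "real ^ 'n" assume "b \<in> Basis"
    then obtain k where b: "b = axis k 1" by (auto simp: Basis_vec_def)
    have "smooth_on S (\<lambda>z. det (?N k z) * inverse (det (M z)))"
      by (intro smooth_on_mult S smooth_det N smooth_on_inverse det M)
    then show "smooth_on S (\<lambda>z. ?P z \<bullet> b)"
      by (simp add: b inner_axis divide_inverse)
  qed
qed

text \<open>The additivity and homogeneity identities hold on the open set \<open>S\<close>, so they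
  can be differentiated at \<open>z\<close>.\<close>

lemma bilinear_fd_family:
  fixes G :: "'c::euclidean_space \<Rightarrow> 'a::euclidean_space \<Rightarrow> 'b::euclidean_space \<Rightarrow> real"
  assumes S: "open S" "z \<in> S" and bil: "\<And>z. z \<in> S \<Longrightarrow> bilinear (G z)"
    and G: "\<And>a b. (\<lambda>z. G z a b) differentiable (at z)"
  shows "bilinear (\<lambda>a b. fd (\<lambda>y. G y a b) z v)"
proof -
  note d = fd_has_derivative[OF G]
  have "fd (\<lambda>y. G y (a + a') b) z = (\<lambda>v. fd (\<lambda>y. G y a b) z v + fd (\<lambda>y. G y a' b) z v)" for a a' b
    by (rule fd_eqI, rule has_derivative_transform_within_open[OF has_derivative_add[OF d d] S])
      (simp add: bilinear_ladd[OF bil])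
  moreover have "fd (\<lambda>y. G y a (b + b')) z = (\<lambda>v. fd (\<lambda>y. G y a b) z v + fd (\<lambda>y. G y a b') z v)" for a b b'
    by (rule fd_eqI, rule has_derivative_transform_within_open[OF has_derivative_add[OF d d] S])
      (simp add: bilinear_radd[OF bil])
  moreover have "fd (\<lambda>y. G y (r *\<^sub>R a) b) z = (\<lambda>v. r * fd (\<lambda>y. G y a b) z v)" for r a b
    by (rule fd_eqI, rule has_derivative_transform_within_open[OF has_derivative_mult_right[OF d] S])
      (simp add: bilinear_lmul[OF bil])
  moreover have "fd (\<lambda>y. G y a (r *\<^sub>R b)) z = (\<lambda>v. r * fd (\<lambda>y. G y a b) z v)" for r a b
    by (rule fd_eqI, rule has_derivative_transform_within_open[OF has_derivative_mult_right[OF d] S])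
      (simp add: bilinear_rmul[OF bil])
  ultimately show ?thesis by (simp add: bilinear_def linear_iff)
qed

text \<open>The inner derivative is a function on the manifold; read back in the chart it is
  evaluated at \<open>x (ix z)\<close>, which is \<open>z\<close> only on the open image of the
  chart.\<close>

lemma (in atlas_chart) chart_deriv_chart_deriv:
  assumes "p \<in> U"
  shows "chart_deriv (U, x) a (chart_deriv (U, x) b f) p = fd (\<lambda>z. fd (\<lambda>z. f (ix z)) z b) (x p) a"
proof -
  have xp: "x p \<in> x ` U" using assms by simp
  have "fd (\<lambda>z. fd (\<lambda>z. f (ix z)) (x (ix z)) b) (x p) = fd (\<lambda>z. fd (\<lambda>z. f (ix z)) z b) (x p)"
    by (rule fd_cong_open[OF open_xU xp]) simp
  then show ?thesis by (simp add: chart_deriv_def o_def)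
qed

section \<open>Dombrowski's structure in affine coordinates\<close>

locale affine_chart = bundle_chart A U x
  for A :: "('m, real ^ 'n) atlas" and U :: "'m set" and x :: "'m \<Rightarrow> real ^ 'n" +
  fixes h :: "'m \<Rightarrow> 'm tvec \<Rightarrow> 'm tvec \<Rightarrow> real" and nabla nabla' D :: "'m conn"
    and K :: "'m tbundle \<Rightarrow> 'm tbundle tvec \<Rightarrow> 'm tvec"
  assumes riem: "riemannian_metric A h"
    and dual: "dual_connections A h nabla nabla'"
    and torsion_dual: "torsion_free A nabla'"
    and flat: "\<And>p c a. p \<in> U \<Longrightarrow> nabla (E c) (E a) p = 0"
    and lc: "levi_civita A h D"
    and connector: "is_connector A nabla K"
begin

abbreviation S :: "((real ^ 'n) \<times> (real ^ 'n)) set" where "S \<equiv> (x ` U) \<times> UNIV"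

abbreviation H :: "real ^ 'n \<Rightarrow> real ^ 'n \<Rightarrow> real ^ 'n \<Rightarrow> real" where "H \<equiv> metric h"

definition G :: "(real ^ 'n) \<times> (real ^ 'n) \<Rightarrow> (real ^ 'n) \<times> (real ^ 'n) \<Rightarrow> (real ^ 'n) \<times> (real ^ 'n) \<Rightarrow> real" where
  "G z a b = H (fst z) (fst a) (fst b) + H (fst z) (snd a) (snd b)"

lemma open_S: "open S"
  using open_xU by (simp add: open_Times)

lemma tx_S: "tx ` bundle_over A U = S"
  by (rule tx_image[OF subset_refl])

lemma tx_in_S: "u \<in> bundle_over A U \<Longrightarrow> tx u \<in> S"
  using tx_S by blast

lemma bundle_point:
  assumes "u \<in> bundle_over A U"
  obtains p \<eta> where "p \<in> U" "u = (p, E \<eta> p)" "tx u = (x p, \<eta>)"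
  using assms bundle_over_iff[OF subset_refl] tx_coord_vector by metis

lemma bilinear_H: "z \<in> S \<Longrightarrow> bilinear (H (fst z))"
  using metric_bilinear[OF riem] by auto

lemma sym_H: "z \<in> S \<Longrightarrow> H (fst z) a b = H (fst z) b a"
  using metric_sym[OF riem] by auto

lemma smooth_H: "smooth_on S (\<lambda>z. H (fst z) a b)"
  by (rule smooth_on_compose[OF open_S _ metric_smooth[OF riem] smooth_on_linear[OF bounded_linear_fst]]) auto

lemma bilinear_G:
  assumes "z \<in> S"
  shows "bilinear (G z)"
proof -
  note b = bilinear_H[OF assms]
  show ?thesis
    by (simp add: bilinear_def linear_iff G_def bilinear_ladd[OF b] bilinear_radd[OF b]
        bilinear_lmul[OF b] bilinear_rmul[OF b] algebra_simps)
qed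

lemma smooth_G: "smooth_on S (\<lambda>z. G z a b)"
  unfolding G_def by (intro smooth_on_add open_S smooth_H)

lemma H_nondegenerate:
  assumes z: "z \<in> S" and eq: "\<And>b. H (fst z) a b = H (fst z) a' b"
  shows "a = a'"
proof (rule ccontr)
  assume "a \<noteq> a'"
  then have "H (fst z) (a - a') (a - a') > 0"
    using z by (intro metric_pos[OF riem]) auto
  then show False using eq by (simp add: bilinear_lsub[OF bilinear_H[OF z]])
qed

lemma push_proj_TM:
  assumes "u \<in> bundle_over A U"
  shows "push_proj A u (TM.E a u) = E (fst a) (fst u)"
  using assms by (rule bundle_point) (use push_proj_coord_vector[of _ _ "fst a" "snd a"] in simp)

lemma connector_TM:
  assumes "u \<in> bundle_over A U"
  shows "K u (TM.E a u) = E (snd a) (fst u)"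
proof -
  obtain p \<eta> where p: "p \<in> U" "u = (p, E \<eta> p)" using bundle_point[OF assms] .
  have "affine_connection A nabla" using dual by (simp add: dual_connections_def)
  from connector_coord_vector[OF this flat[OF p(1)] connector p(1), of \<eta> "fst a" "snd a"]
  show ?thesis using p by simp
qed

lemma dombrowski_g_TM:
  assumes u: "u \<in> bundle_over A U"
  shows "dombrowski_g A h K u (TM.E a u) (TM.E b u) = G (tx u) a b"
proof -
  obtain p \<eta> where p: "p \<in> U" "u = (p, E \<eta> p)" "tx u = (x p, \<eta>)" using bundle_point[OF u] .
  then have "fst u = p" "fst (tx u) = x p" by auto
  then show ?thesis
    unfolding dombrowski_g_def push_proj_TM[OF u] connector_TM[OF u] G_def
    using p(1) by (simp add: metric_x)
qed

text \<open>The description defining \<open>J\<close> has a unique solution because the pair formed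
  by the differential of the projection and the connector determines both components of a
  vector.\<close>

lemma dombrowski_J_TM:
  assumes u: "u \<in> bundle_over A U"
  shows "dombrowski_J A K u (TM.E a u) = TM.E (- snd a, fst a) u"
proof -
  have fu: "fst u \<in> U" using u by (auto simp: bundle_over_def)
  show ?thesis
    unfolding dombrowski_J_def
  proof (rule the_equality)
    show "TM.E (- snd a, fst a) u \<in> tangent_space (tangent_atlas A) u \<and>
        push_proj A u (TM.E (- snd a, fst a) u) = - K u (TM.E a u) \<and>
        K u (TM.E (- snd a, fst a) u) = push_proj A u (TM.E a u)"
      using fu TM.coord_vector_mem[OF u]
      by (simp add: push_proj_TM[OF u] connector_TM[OF u] coord_vector_minus)
    fix b assume b: "b \<in> tangent_space (tangent_atlas A) u \<and>
        push_proj A u b = - K u (TM.E a u) \<and> K u b = push_proj A u (TM.E a u)"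
    then obtain c where c: "b = TM.E c u" using TM.tangent_space_chart[OF u] by auto
    have "E (fst c) (fst u) = E (- snd a) (fst u)" "E (snd c) (fst u) = E (fst a) (fst u)"
      using b fu by (simp_all add: c push_proj_TM[OF u] connector_TM[OF u] coord_vector_minus)
    then have "c = (- snd a, fst a)" using coord_vector_inject[OF fu] by (simp add: prod_eq_iff)
    then show "b = TM.E (- snd a, fst a) u" using c by simp
  qed
qed

lemma dombrowski_omega_TM:
  assumes u: "u \<in> bundle_over A U"
  shows "dombrowski_omega A h K u (TM.E a u) (TM.E b u) = G (tx u) (- snd a, fst a) b"
  by (simp add: dombrowski_omega_def dombrowski_J_TM[OF u] dombrowski_g_TM[OF u])

text \<open>A vector in the kernel of the matrix is orthogonal to all axis vectors, hence to
  everything, and is zero by nondegeneracy.\<close>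

lemma H_det:
  assumes z: "z \<in> S"
  shows "det (\<chi> i j. H (fst z) (axis i 1) (axis j 1)) \<noteq> 0"
proof -
  let ?M = "\<chi> i j. H (fst z) (axis i 1) (axis j 1)"
  have "v = 0" if v: "?M *v v = 0" for v
  proof -
    have lin: "linear (H (fst z) a)" "linear (\<lambda>a. H (fst z) a b)" for a b
      using bilinear_H[OF z] by (auto simp: bilinear_def)
    have "H (fst z) (axis i 1) v = 0" for i
      using v linear_expand_axis[OF lin(1)[of "axis i 1"], of v]
      by (simp add: matrix_vector_mult_def vec_eq_iff mult.commute)
    then have "H (fst z) b v = H (fst z) b 0" for b
      using linear_expand_axis[OF lin(2), of b v] bilinear_rzero[OF bilinear_H[OF z]] by simp
    then show ?thesis using sym_H[OF z] by (intro H_nondegenerate[OF z]) metis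
  qed
  then have "\<exists>B. B ** ?M = mat 1" using matrix_left_invertible_ker by blast
  then show ?thesis using invertible_left_inverse invertible_det_nz by blast
qed

text \<open>Raising an index: a smooth family of linear forms is represented through the metric by a
  smooth family of vectors.\<close>

lemma smooth_representative:
  assumes lin: "\<And>z. z \<in> S \<Longrightarrow> linear (l z)" and l: "\<And>b. smooth_on S (\<lambda>z. l z b)"
  obtains P where "smooth_on S P" "\<And>z b. z \<in> S \<Longrightarrow> H (fst z) (P z) b = l z b"
proof -
  have "\<exists>P. smooth_on S P \<and>
      (\<forall>z\<in>S. (\<chi> i j. H (fst z) (axis i 1) (axis j 1)) *v P z = (\<chi> i. l z (axis i 1)))"
    by (rule smooth_linear_system[OF open_S _ _ H_det]) (simp_all add: smooth_H l)
  then obtain P where P: "smooth_on S P"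
    and eq: "\<And>z. z \<in> S \<Longrightarrow> (\<chi> i j. H (fst z) (axis i 1) (axis j 1)) *v P z = (\<chi> i. l z (axis i 1))" by blast
  show ?thesis
  proof (rule that[OF P])
    fix z b assume z: "z \<in> S"
    have linH: "linear (H (fst z) a)" "linear (\<lambda>a. H (fst z) a b)" for a b
      using bilinear_H[OF z] by (auto simp: bilinear_def)
    have 1: "H (fst z) (axis i 1) (P z) = l z (axis i 1)" for i
      using eq[OF z] linear_expand_axis[OF linH(1)[of "axis i 1"], of "P z"]
      by (simp add: matrix_vector_mult_def vec_eq_iff mult.commute)
    show "H (fst z) (P z) b = l z b"
      unfolding sym_H[OF z, of "P z" b] linear_expand_axis[OF linH(2), of b "P z"]
        linear_expand_axis[OF lin[OF z], of b]
      by (simp add: 1)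
  qed
qed

end

text \<open>\<open>P\<close> and \<open>Q\<close> are parameters with their defining relations, so
  the computations below depend on these relations and on smoothness only, not on how the two
  functions were found.\<close>

locale affine_chart_function = affine_chart A U x h nabla nabla' D K
  for A :: "('m, real ^ 'n) atlas" and U :: "'m set" and x :: "'m \<Rightarrow> real ^ 'n"
    and h nabla nabla' D K +
  fixes f :: "'m tbundle \<Rightarrow> real" and P Q :: "(real ^ 'n) \<times> (real ^ 'n) \<Rightarrow> real ^ 'n"
  assumes smooth_f: "smooth_fun (tangent_atlas A) (bundle_over A U) f"
    and smooth_P: "smooth_on S P" and smooth_Q: "smooth_on S Q"
    and H_P: "\<And>z b. z \<in> S \<Longrightarrow> H (fst z) (P z) b = fd (\<lambda>z. f (TM.ix z)) z (0, b)"
    and H_Q: "\<And>z b. z \<in> S \<Longrightarrow> H (fst z) (Q z) b = - fd (\<lambda>z. f (TM.ix z)) z (b, 0)"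
begin

section \<open>The Hamiltonian field and the Lie derivative of \<open>g\<close>\<close>

abbreviation F :: "(real ^ 'n) \<times> (real ^ 'n) \<Rightarrow> real" where
  "F \<equiv> \<lambda>z. f (TM.ix z)"

lemma smooth_F: "smooth_on S F"
  using smooth_f TM.smooth_fun_chart[OF TM.open_U subset_refl] by (simp add: tx_S)

lemma hamiltonian_field_TM:
  assumes u: "u \<in> bundle_over A U"
  shows "hamiltonian_field (tangent_atlas A) (dombrowski_omega A h K) f u = TM.E (P (tx u), Q (tx u)) u"
proof -
  let ?z = "tx u"
  have z: "?z \<in> S" using tx_in_S[OF u] .
  note b = bilinear_H[OF z]
  have ef: "TM.E c u f = fd F ?z c" for c
  proof -
    have "smooth_near (tangent_atlas A) u f"
      using smooth_f TM.open_U u unfolding smooth_near_def by blast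
    from TM.coord_vector_apply[OF this] show ?thesis .
  qed
  have lin: "linear (fd F ?z)"
    using smooth_on_differentiable[OF smooth_F z] by (rule linear_frechet_derivative)
  have omega: "G ?z (- Q ?z, P ?z) c = fd F ?z c" for c
  proof -
    have "G ?z (- Q ?z, P ?z) c = fd F ?z (fst c, 0) + fd F ?z (0, snd c)"
      by (simp add: G_def bilinear_lneg[OF b] H_P[OF z] H_Q[OF z])
    also have "\<dots> = fd F ?z c" using linear_add[OF lin, of "(fst c, 0)" "(0, snd c)"] by simp
    finally show ?thesis .
  qed
  show ?thesis
    unfolding hamiltonian_field_def
  proof (rule the_equality)
    show "TM.E (P ?z, Q ?z) u \<in> tangent_space (tangent_atlas A) u \<and>
      (\<forall>b\<in>tangent_space (tangent_atlas A) u. dombrowski_omega A h K u (TM.E (P ?z, Q ?z) u) b = b f)"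
      unfolding TM.tangent_space_chart[OF u] by (auto simp: dombrowski_omega_TM[OF u] omega ef)
    fix a assume a: "a \<in> tangent_space (tangent_atlas A) u \<and>
      (\<forall>b\<in>tangent_space (tangent_atlas A) u. dombrowski_omega A h K u a b = b f)"
    then obtain c where c: "a = TM.E c u" using TM.tangent_space_chart[OF u] by auto
    have eq: "G ?z (- snd c, fst c) d = fd F ?z d" for d
      using a TM.coord_vector_mem[OF u, of d] ef[of d] by (simp add: c dombrowski_omega_TM[OF u, symmetric])
    \<comment> \<open>Purely vertical and purely horizontal test vectors isolate the two components
      of \<open>c\<close>.\<close>
    have "H (fst ?z) (fst c) d = H (fst ?z) (P ?z) d" for d
      using eq[of "(0, d)"] by (simp add: G_def bilinear_rzero[OF b] H_P[OF z])
    moreover have "H (fst ?z) (snd c) d = H (fst ?z) (Q ?z) d" for d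
      using eq[of "(d, 0)"] by (simp add: G_def bilinear_rzero[OF b] bilinear_lneg[OF b] H_Q[OF z])
    ultimately have "c = (P ?z, Q ?z)"
      using H_nondegenerate[OF z] by (simp add: prod_eq_iff)
    then show "a = TM.E (P ?z, Q ?z) u" using c by simp
  qed
qed

definition X :: "(real ^ 'n) \<times> (real ^ 'n) \<Rightarrow> (real ^ 'n) \<times> (real ^ 'n)" where
  "X z = (P z, Q z)"

text \<open>The Lie derivative of \<open>g\<close> along the Hamiltonian field as a field of
  bilinear forms on the model space, obtained from \<open>lie_derivative_chart\<close> with the
  values of the two fields as arguments.\<close>

definition LG :: "(real ^ 'n) \<times> (real ^ 'n) \<Rightarrow> (real ^ 'n) \<times> (real ^ 'n) \<Rightarrow> (real ^ 'n) \<times> (real ^ 'n) \<Rightarrow> real" where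
  "LG z a b = fd (\<lambda>z. G z a b) z (X z) + G z (fd X z a) b + G z a (fd X z b)"

lemma smooth_X: "smooth_on S X"
  unfolding X_def[abs_def] by (rule smooth_on_Pair[OF open_S smooth_P smooth_Q])

lemma lie_derivative_TM:
  assumes V: "manifold_open (tangent_atlas A) V" "V \<subseteq> bundle_over A U" and u: "u \<in> V"
    and \<eta>: "smooth_on (tx ` V) \<eta>" "\<And>u. u \<in> V \<Longrightarrow> Y u = TM.E (\<eta> (tx u)) u"
    and \<zeta>: "smooth_on (tx ` V) \<zeta>" "\<And>u. u \<in> V \<Longrightarrow> Z u = TM.E (\<zeta> (tx u)) u"
  shows "lie_derivative (tangent_atlas A) (hamiltonian_field (tangent_atlas A) (dombrowski_omega A h K) f)
    (dombrowski_g A h K) Y Z u = LG (tx u) (\<eta> (tx u)) (\<zeta> (tx u))"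
  unfolding LG_def
proof (rule TM.lie_derivative_chart[OF V u, where G=G and \<eta>=\<eta> and \<zeta>=\<zeta> and \<xi>=X])
  show "dombrowski_g A h K q (TM.E a q) (TM.E b q) = G (tx q) a b" if "q \<in> bundle_over A U" for q a b
    using that by (rule dombrowski_g_TM)
  have sub: "tx ` V \<subseteq> S" using image_mono[OF V(2), of tx] by (simp add: tx_S)
  show "smooth_on (tx ` V) X" by (rule smooth_on_subset[OF smooth_X sub])
  show "hamiltonian_field (tangent_atlas A) (dombrowski_omega A h K) f q = TM.E (X (tx q)) q" if "q \<in> V" for q
    unfolding X_def using V(2) that by (intro hamiltonian_field_TM) auto
  show "bilinear (G z)" if "z \<in> tx ` bundle_over A U" for z
    using that unfolding tx_S by (rule bilinear_G)
  show "smooth_on (tx ` bundle_over A U) (\<lambda>z. G z a b)" for a b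
    unfolding tx_S by (rule smooth_G)
qed (use \<eta> \<zeta> in auto)

lemma kaehler_function_lie_derivative:
  assumes "kaehler_function_on B g \<omega> W f" "manifold_open B V" "V \<subseteq> W"
    "smooth_field B V Y" "smooth_field B V Z" "p \<in> V"
  shows "lie_derivative B (hamiltonian_field B \<omega> f) g Y Z p = 0"
  using assms by (simp add: kaehler_function_on_def)

text \<open>By tensoriality it is enough to test on fields with constant components, which are
  defined on the whole bundle over \<open>U\<close>; conversely the values of arbitrary fields at a
  point are such vectors.\<close>

lemma kaehler_iff_LG:
  "kaehler_function_on (tangent_atlas A) (dombrowski_g A h K) (dombrowski_omega A h K) (bundle_over A U) f
    \<longleftrightarrow> (\<forall>z\<in>S. \<forall>a b. LG z a b = 0)" (is "?k \<longleftrightarrow> ?l")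
proof
  assume k: ?k
  show ?l
  proof (intro ballI allI)
    fix z a b assume "z \<in> S"
    then obtain u where u: "u \<in> bundle_over A U" "z = tx u" using tx_S by blast
    note sm = TM.smooth_field_const[OF TM.open_U subset_refl]
    have "lie_derivative (tangent_atlas A) (hamiltonian_field (tangent_atlas A) (dombrowski_omega A h K) f)
      (dombrowski_g A h K) (TM.E a) (TM.E b) u = LG (tx u) a b"
      by (rule lie_derivative_TM[OF TM.open_U subset_refl u(1)]) (simp_all add: smooth_on_const)
    moreover have "lie_derivative (tangent_atlas A) (hamiltonian_field (tangent_atlas A) (dombrowski_omega A h K) f)
      (dombrowski_g A h K) (TM.E a) (TM.E b) u = 0"
      by (rule kaehler_function_lie_derivative[OF k TM.open_U subset_refl sm sm u(1)])
    ultimately show "LG z a b = 0" using u by simp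
  qed
next
  assume l: ?l
  show ?k
    unfolding kaehler_function_on_def
  proof (intro conjI smooth_f allI impI ballI)
    fix V Y Z u
    assume V: "manifold_open (tangent_atlas A) V \<and> V \<subseteq> bundle_over A U \<and>
      smooth_field (tangent_atlas A) V Y \<and> smooth_field (tangent_atlas A) V Z" and u: "u \<in> V"
    then have V': "manifold_open (tangent_atlas A) V" "V \<subseteq> bundle_over A U" by auto
    obtain \<eta> where \<eta>: "smooth_on (tx ` V) \<eta>" "\<And>u. u \<in> V \<Longrightarrow> Y u = TM.E (\<eta> (tx u)) u"
      using V TM.smooth_field_chart[OF V'] by blast
    obtain \<zeta> where \<zeta>: "smooth_on (tx ` V) \<zeta>" "\<And>u. u \<in> V \<Longrightarrow> Z u = TM.E (\<zeta> (tx u)) u"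
      using V TM.smooth_field_chart[OF V'] by blast
    have "lie_derivative (tangent_atlas A) (hamiltonian_field (tangent_atlas A) (dombrowski_omega A h K) f)
      (dombrowski_g A h K) Y Z u = LG (tx u) (\<eta> (tx u)) (\<zeta> (tx u))"
      by (rule lie_derivative_TM[OF V' u \<eta> \<zeta>])
    moreover have "tx u \<in> S" using tx_in_S V'(2) u by blast
    ultimately show "lie_derivative (tangent_atlas A)
      (hamiltonian_field (tangent_atlas A) (dombrowski_omega A h K) f) (dombrowski_g A h K) Y Z u = 0"
      using l by simp
  qed
qed

text \<open>In affine coordinates these are the components of the cubic form, the covariant
  derivative of \<open>h\<close> with respect to \<open>nabla\<close>; the last argument is the
  direction of differentiation.\<close>

abbreviation T :: "(real ^ 'n) \<times> (real ^ 'n) \<Rightarrow> real ^ 'n \<Rightarrow> real ^ 'n \<Rightarrow> real ^ 'n \<Rightarrow> real" where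
  "T z a b c \<equiv> fd (\<lambda>y. H y a b) (fst z) c"

lemma fd_H_fst:
  assumes z: "z \<in> S"
  shows "((\<lambda>z. H (fst z) a b) has_derivative (\<lambda>v. T z a b (fst v))) (at z)"
proof -
  have "fst z \<in> x ` U" using z by auto
  from has_derivative_compose[OF has_derivative_fst[OF has_derivative_ident]
      smooth_on_has_derivative[OF metric_smooth[OF riem] this]]
  show ?thesis .
qed

lemma T_sym:
  assumes z: "z \<in> S"
  shows "T z a b c = T z b a c" and "T z a b c = T z a c b"
proof -
  have fz: "fst z \<in> x ` U" using z by auto
  show "T z a b c = T z b a c" by (rule metric_fd_commute[OF riem fz])
  show "T z a b c = T z a c b"
    using metric_fd_symmetric[OF riem dual torsion_dual flat, of "ix (fst z)"] fz by simp
qed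

lemma T_christoffel:
  assumes z: "z \<in> S"
  shows "T z (axis i 1) (axis j 1) v =
    2 * (\<Sum>b\<in>UNIV. christoffel A D (U, x) i j b (ix (fst z)) * H (fst z) (axis b 1) v)"
proof -
  let ?p = "ix (fst z)"
  have fz: "fst z \<in> x ` U" using z by auto
  then have p: "?p \<in> U" "x ?p = fst z" by auto
  have conn: "affine_connection A D" using lc by (simp add: levi_civita_def dual_connections_def)
  define c where "c = coords (D (E (axis i 1)) (E (axis j 1)) ?p)"
  have "D (E (axis i 1)) (E (axis j 1)) ?p = E c ?p"
    unfolding c_def by (rule coord_vector_coords[OF p(1) connection_mem[OF conn p(1)], symmetric])
  then have ch: "christoffel A D (U, x) i j b ?p = c $ b" for b
    using p(1) by (simp add: christoffel_def coord_vector_nth)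
  have "T z (axis j 1) v (axis i 1) = 2 * H (fst z) c v"
    unfolding c_def
    using levi_civita_symmetric_fd[OF riem lc p(1), of "axis i 1" "axis j 1" v] T_sym(2)[OF z] p(2) by simp
  \<comment> \<open>The Koszul argument differentiates along \<open>axis i 1\<close>; total symmetry
    moves \<open>v\<close> into the slot of the direction.\<close>
  moreover have "T z (axis i 1) (axis j 1) v = T z (axis j 1) v (axis i 1)"
    using T_sym[OF z] by metis
  moreover have "linear (\<lambda>a. H (fst z) a v)" using bilinear_H[OF z] by (simp add: bilinear_def)
  from linear_expand_axis[OF this, of c]
  have "H (fst z) c v = (\<Sum>b\<in>UNIV. c $ b * H (fst z) (axis b 1) v)" by simp
  ultimately show ?thesis by (simp add: ch)
qed

text \<open>The relation \<open>H_P\<close> is differentiated and solved for the term containing the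
  derivative of \<open>P\<close>. The metric depends on the base point only, so \<open>T\<close>
  sees just \<open>fst c\<close>.\<close>

lemma H_fd_P:
  assumes z: "z \<in> S"
  shows "H (fst z) (fd P z c) b = fd (\<lambda>z. fd F z (0, b)) z c - T z (P z) b (fst c)"
proof -
  have "((\<lambda>z. H (fst z) (P z) b) has_derivative
    (\<lambda>v. fd (\<lambda>y. H (fst y) (P z) b) z v + H (fst z) (fd P z v) b + H (fst z) (P z) 0)) (at z)"
    by (rule has_derivative_bilinear_family[OF open_S z bilinear_H smooth_on_differentiable[OF smooth_H z]
        smooth_on_has_derivative[OF smooth_P z] has_derivative_const])
  then have "fd (\<lambda>z. H (fst z) (P z) b) z c = T z (P z) b (fst c) + H (fst z) (fd P z c) b"
    by (simp add: fd_eqI fd_eqI[OF fd_H_fst[OF z]] bilinear_rzero[OF bilinear_H[OF z]])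
  moreover have "fd (\<lambda>z. H (fst z) (P z) b) z = fd (\<lambda>z. fd F z (0, b)) z"
    by (rule fd_cong_open[OF open_S z H_P])
  ultimately show ?thesis by simp
qed

lemma H_fd_Q:
  assumes z: "z \<in> S"
  shows "H (fst z) (fd Q z c) b = - fd (\<lambda>z. fd F z (b, 0)) z c - T z (Q z) b (fst c)"
proof -
  have "((\<lambda>z. H (fst z) (Q z) b) has_derivative
    (\<lambda>v. fd (\<lambda>y. H (fst y) (Q z) b) z v + H (fst z) (fd Q z v) b + H (fst z) (Q z) 0)) (at z)"
    by (rule has_derivative_bilinear_family[OF open_S z bilinear_H smooth_on_differentiable[OF smooth_H z]
        smooth_on_has_derivative[OF smooth_Q z] has_derivative_const])
  then have "fd (\<lambda>z. H (fst z) (Q z) b) z c = T z (Q z) b (fst c) + H (fst z) (fd Q z c) b"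
    by (simp add: fd_eqI fd_eqI[OF fd_H_fst[OF z]] bilinear_rzero[OF bilinear_H[OF z]])
  moreover have "fd (\<lambda>z. H (fst z) (Q z) b) z = fd (\<lambda>z. - fd F z (b, 0)) z"
    by (rule fd_cong_open[OF open_S z H_Q])
  moreover have "fd (\<lambda>z. - fd F z (b, 0)) z = (\<lambda>v. - fd (\<lambda>z. fd F z (b, 0)) z v)"
    by (intro fd_eqI has_derivative_minus smooth_on_has_derivative[OF smooth_on_fd[OF smooth_F] z])
  ultimately show ?thesis by simp
qed

text \<open>Since \<open>G\<close> depends on the base point only, its derivative along the field
  involves \<open>P\<close> and not \<open>Q\<close>.\<close>

lemma LG_eq:
  assumes z: "z \<in> S"
  shows "LG z a b = T z (fst a) (fst b) (P z) + T z (snd a) (snd b) (P z) +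
    H (fst z) (fd P z a) (fst b) + H (fst z) (fd Q z a) (snd b) +
    H (fst z) (fd P z b) (fst a) + H (fst z) (fd Q z b) (snd a)"
proof -
  have "(X has_derivative (\<lambda>v. (fd P z v, fd Q z v))) (at z)"
    unfolding X_def[abs_def]
    by (intro has_derivative_Pair smooth_on_has_derivative[OF smooth_P z] smooth_on_has_derivative[OF smooth_Q z])
  then have "fd X z = (\<lambda>v. (fd P z v, fd Q z v))" by (rule fd_eqI)
  moreover have "fd (\<lambda>z. G z a b) z = (\<lambda>v. T z (fst a) (fst b) (fst v) + T z (snd a) (snd b) (fst v))"
    unfolding G_def by (intro fd_eqI has_derivative_add fd_H_fst[OF z])
  ultimately show ?thesis
    using sym_H[OF z] by (simp add: LG_def G_def X_def)
qed

text \<open>Allows the vanishing of the tensor to be tested on pairs of basis vectors.\<close>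

lemma LG_bilinear:
  assumes z: "z \<in> S"
  shows "bilinear (LG z)"
proof -
  note b = bilinear_G[OF z]
    and f = bilinear_fd_family[OF open_S z bilinear_G smooth_on_differentiable[OF smooth_G z], of "X z"]
  have lin: "linear (fd X z)"
    using smooth_on_differentiable[OF smooth_X z] by (rule linear_frechet_derivative)
  show ?thesis
    using bilinear_ladd[OF f] bilinear_radd[OF f] bilinear_lmul[OF f] bilinear_rmul[OF f]
    by (simp add: bilinear_def linear_iff LG_def linear_add[OF lin] linear_scale[OF lin]
        bilinear_ladd[OF b] bilinear_radd[OF b] bilinear_lmul[OF b] bilinear_rmul[OF b] algebra_simps)
qed

text \<open>The nesting of the derivatives follows \<open>deriv_x A c i (deriv_x A c j f)\<close>
  and its analogues, so that the final translation is plain rewriting.\<close>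

abbreviation (input) eq1 where
  "eq1 z i j \<equiv> fd (\<lambda>z. fd F z (axis j 1, 0)) z (axis i 1, 0) - fd (\<lambda>z. fd F z (0, axis j 1)) z (0, axis i 1)
    = 2 * (\<Sum>b\<in>UNIV. christoffel A D (U, x) i j b (ix (fst z)) * fd F z (axis b 1, 0))"

abbreviation (input) eq2 where
  "eq2 z i j \<equiv> fd (\<lambda>z. fd F z (0, axis j 1)) z (axis i 1, 0) + fd (\<lambda>z. fd F z (0, axis i 1)) z (axis j 1, 0)
    = 2 * (\<Sum>b\<in>UNIV. christoffel A D (U, x) i j b (ix (fst z)) * fd F z (0, axis b 1))"

text \<open>Horizontal block: \<open>T\<close> along \<open>P\<close> occurs once with plus, and
  twice with minus through \<open>H_fd_P\<close>, so one copy with minus is left next to the mixed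
  second derivatives. Vertical block: vertical directions do not change the metric, so one copy with
  plus is left and the second derivatives carry a minus sign; the equation is the same. Mixed block:
  only \<open>T\<close> contracted with \<open>Q\<close> survives, and the minus sign in
  \<open>H_Q\<close> gives the first equation its right-hand side.\<close>

lemma LG_basis:
  assumes z: "z \<in> S"
  shows "LG z (axis i 1, 0) (axis j 1, 0) = 0 \<longleftrightarrow> eq2 z i j"
    and "LG z (0, axis i 1) (0, axis j 1) = 0 \<longleftrightarrow> eq2 z i j"
    and "LG z (axis i 1, 0) (0, axis j 1) = 0 \<longleftrightarrow> eq1 z i j"
    and "LG z (0, axis j 1) (axis i 1, 0) = 0 \<longleftrightarrow> eq1 z i j"
proof -
  have fz: "fst z \<in> x ` U" using z by auto
  have bT: "bilinear (\<lambda>a b. T z a b c)" for c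
    by (rule bilinear_fd_family[OF open_xU fz metric_bilinear[OF riem] smooth_on_differentiable[OF metric_smooth[OF riem] fz]])
  have T0: "T z a b 0 = 0" for a b
    by (rule linear_0[OF linear_frechet_derivative[OF smooth_on_differentiable[OF metric_smooth[OF riem] fz]]])
  note zero = bilinear_lzero[OF bT] bilinear_rzero[OF bT] T0
    bilinear_lzero[OF bilinear_H[OF z]] bilinear_rzero[OF bilinear_H[OF z]]
  have comm: "fd (\<lambda>z. fd F z a) z b = fd (\<lambda>z. fd F z b) z a" for a b
    by (rule fd_commute[OF open_S smooth_F z])
  have TP: "T z (axis i 1) (axis j 1) (P z) =
      2 * (\<Sum>b\<in>UNIV. christoffel A D (U, x) i j b (ix (fst z)) * fd F z (0, axis b 1))"
    by (simp add: T_christoffel[OF z] sym_H[OF z, of _ "P z"] H_P[OF z])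
  have TQ: "T z (axis i 1) (axis j 1) (Q z) =
      - 2 * (\<Sum>b\<in>UNIV. christoffel A D (U, x) i j b (ix (fst z)) * fd F z (axis b 1, 0))"
    by (simp add: T_christoffel[OF z] sym_H[OF z, of _ "Q z"] H_Q[OF z] sum_negf)
  have perm: "T z v (axis j 1) (axis i 1) = T z (axis i 1) (axis j 1) v"
    "T z v (axis i 1) (axis j 1) = T z (axis i 1) (axis j 1) v" for v
    using T_sym[OF z] by metis+
  show "LG z (axis i 1, 0) (axis j 1, 0) = 0 \<longleftrightarrow> eq2 z i j"
    by (simp add: LG_eq[OF z] H_fd_P[OF z] zero perm TP) linarith
  show "LG z (0, axis i 1) (0, axis j 1) = 0 \<longleftrightarrow> eq2 z i j"
    by (simp add: LG_eq[OF z] H_fd_Q[OF z] zero TP comm[of "(axis _ 1, 0)"]) linarith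
  show *: "LG z (axis i 1, 0) (0, axis j 1) = 0 \<longleftrightarrow> eq1 z i j"
    by (simp add: LG_eq[OF z] H_fd_P[OF z] H_fd_Q[OF z] zero perm TQ comm[of "(axis j 1, 0)"] comm[of "(0, axis j 1)"]) linarith
  have "LG z (0, axis j 1) (axis i 1, 0) = LG z (axis i 1, 0) (0, axis j 1)"
    by (simp add: LG_eq[OF z] zero)
  then show "LG z (0, axis j 1) (axis i 1, 0) = 0 \<longleftrightarrow> eq1 z i j" using * by simp
qed

lemma kaehler_iff_equations:
  "kaehler_function_on (tangent_atlas A) (dombrowski_g A h K) (dombrowski_omega A h K) (bundle_over A U) f
    \<longleftrightarrow> (\<forall>z\<in>S. \<forall>i j. eq1 z i j \<and> eq2 z i j)"
  unfolding kaehler_iff_LG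
proof (intro ball_cong refl)
  fix z assume z: "z \<in> S"
  show "(\<forall>a b. LG z a b = 0) \<longleftrightarrow> (\<forall>i j. eq1 z i j \<and> eq2 z i j)"
  proof
    assume "\<forall>a b. LG z a b = 0"
    then show "\<forall>i j. eq1 z i j \<and> eq2 z i j"
      unfolding LG_basis(1)[OF z, symmetric] LG_basis(3)[OF z, symmetric] by simp
  next
    assume eqs: "\<forall>i j. eq1 z i j \<and> eq2 z i j"
    have "\<exists>i. a = (axis i 1, 0) \<or> a = (0, axis i 1)" if "a \<in> Basis" for a :: "(real ^ 'n) \<times> (real ^ 'n)"
      using that by (auto simp: Basis_prod_def Basis_vec_def)
    note axis = this
    have "LG z a b = 0" if a: "a \<in> Basis" and b: "b \<in> Basis" for a b
    proof -
      obtain i j where "a = (axis i 1, 0) \<or> a = (0, axis i 1)" "b = (axis j 1, 0) \<or> b = (0, axis j 1)"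
        using axis[OF a] axis[OF b] by blast
      \<comment> \<open>A vertical first and a horizontal second argument lead to the first equation
        with its indices exchanged.\<close>
      moreover have "eq1 z i j" "eq1 z j i" "eq2 z i j" using eqs by blast+
      ultimately show ?thesis
        using LG_basis(1,2,3)[OF z, of i j] LG_basis(4)[OF z, of i j] LG_basis(4)[OF z, of j i] by (elim disjE) simp_all
    qed
    then have "LG z a b = 0" for a b
      using bilinear_expand_Basis[OF LG_bilinear[OF z], of a b] by simp
    then show "\<forall>a b. LG z a b = 0" by blast
  qed
qed

end

section \<open>From the coordinates of the tangent bundle back to the manifold\<close>

theorem proposition2p25:
  fixes A :: "('m, real ^ 'n) atlas"
    and h :: "'m \<Rightarrow> 'm tvec \<Rightarrow> 'm tvec \<Rightarrow> real"
    and nabla nabla' D :: "'m conn"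
    and K :: "'m tbundle \<Rightarrow> 'm tbundle tvec \<Rightarrow> 'm tvec"
    and f :: "'m tbundle \<Rightarrow> real"
    and U :: "'m set" and x :: "'m \<Rightarrow> real ^ 'n"
  assumes "smooth_manifold A"
    and "dually_flat A h nabla nabla'"
    and "levi_civita A h D"
    and "is_connector A nabla K"
    and "smooth_fun (tangent_atlas A) (bundle_over A (points A)) f"
    and "affine_coordinates A nabla (U, x)"
  shows "kaehler_function_on (tangent_atlas A) (dombrowski_g A h K) (dombrowski_omega A h K)
           (bundle_over A U) f \<longleftrightarrow>
         (\<forall>u\<in>bundle_over A U. \<forall>i j.
            deriv_x A (U, x) i (deriv_x A (U, x) j f) u
              - deriv_xdot A (U, x) i (deriv_xdot A (U, x) j f) u
            = 2 * (\<Sum>b\<in>UNIV. christoffel A D (U, x) i j b (fst u) * deriv_x A (U, x) b f u) \<and>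
            deriv_x A (U, x) i (deriv_xdot A (U, x) j f) u
              + deriv_x A (U, x) j (deriv_xdot A (U, x) i f) u
            = 2 * (\<Sum>b\<in>UNIV. christoffel A D (U, x) i j b (fst u) * deriv_xdot A (U, x) b f u))"
proof -
  have riem: "riemannian_metric A h" and dual: "dual_connections A h nabla nabla'"
    and tor': "torsion_free A nabla'" using assms(2) by (auto simp: dually_flat_def)
  interpret bundle_chart A U x
  proof
    show "is_chart c" if "c \<in> A" for c
      using assms(1) that by (simp add: smooth_manifold_def)
    show "compatible c d" if "c \<in> A" "d \<in> A" for c d
      using assms(1) that by (simp add: smooth_manifold_def)
    show "(U, x) \<in> A"
      using assms(6) by (simp add: affine_coordinates_def)
  qed
  \<comment> \<open>The Christoffel symbols concern only the axis fields; bilinearity extends the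
    vanishing to all fields with constant components.\<close>
  have flat: "nabla (E c) (E a) p = 0" if p: "p \<in> U" for p c a
  proof -
    have conn: "affine_connection A nabla" using dual by (simp add: dual_connections_def)
    let ?n = "\<lambda>c a. coords (nabla (E c) (E a) p)"
    have rep: "E (?n c a) p = nabla (E c) (E a) p" for c a
      by (rule coord_vector_coords[OF p connection_mem[OF conn p]])
    have "?n (axis i 1) (axis j 1) = 0" for i j
    proof -
      have "?n (axis i 1) (axis j 1) $ b = christoffel A nabla (U, x) i j b p" for b
        using coord_vector_nth[OF p, of "?n (axis i 1) (axis j 1)" b] by (simp add: rep christoffel_def)
      then show ?thesis using assms(6) p by (simp add: affine_coordinates_def vec_eq_iff)
    qed
    then have "?n c a = 0" if "c \<in> Basis" "a \<in> Basis" for c a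
      using that by (auto simp: Basis_vec_def)
    then have "?n = (\<lambda>c a. 0)"
      by (intro bilinear_eq_stdbasis[OF connection_bilinear[OF conn p]]) (auto simp: bilinear_def linear_iff)
    then show ?thesis using rep[of c a] p by (simp add: coord_vector_zero fun_eq_iff)
  qed
  interpret affine_chart A U x h nabla nabla' D K
    by unfold_locales (fact riem dual tor' flat assms(3,4))+
  let ?F = "\<lambda>z. f (TM.ix z)"
  have f: "smooth_fun (tangent_atlas A) (bundle_over A U) f"
    by (rule TM.smooth_fun_subset[OF assms(5)]) (use U_points in \<open>auto simp: bundle_over_def\<close>)
  then have F: "smooth_on S ?F"
    using TM.smooth_fun_chart[OF TM.open_U subset_refl] by (simp add: tx_S)
  have lin: "linear (fd ?F z)" if "z \<in> S" for z
    using smooth_on_differentiable[OF F that] by (rule linear_frechet_derivative)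
  have "linear (\<lambda>b. fd ?F z (0, b))" if "z \<in> S" for z
    using linear_compose[OF _ lin[OF that], of "\<lambda>b. (0, b)"] by (simp add: linear_iff o_def)
  \<comment> \<open>\<open>P\<close> represents the fibre part of the differential of
    \<open>f\<close>, and \<open>Q\<close> below represents minus its base part.\<close>
  then obtain P where P: "smooth_on S P" "\<And>z b. z \<in> S \<Longrightarrow> H (fst z) (P z) b = fd ?F z (0, b)"
    using smooth_representative[of "\<lambda>z b. fd ?F z (0, b)"] smooth_on_fd[OF F] by blast
  have linQ: "linear (\<lambda>b. - fd ?F z (b, 0))" if "z \<in> S" for z
    using linear_compose_neg[OF linear_compose[OF _ lin[OF that], of "\<lambda>b. (b, 0)"]]
    by (simp add: linear_iff o_def)
  have "smooth_on S (\<lambda>z. - fd ?F z (b, 0))" for b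
    by (rule smooth_on_linear_compose[OF bounded_linear_minus[OF bounded_linear_ident] open_S smooth_on_fd[OF F]])
  then obtain Q where Q: "smooth_on S Q" "\<And>z b. z \<in> S \<Longrightarrow> H (fst z) (Q z) b = - fd ?F z (b, 0)"
    using smooth_representative[of "\<lambda>z b. - fd ?F z (b, 0)"] linQ by blast
  interpret affine_chart_function A U x h nabla nabla' D K f P Q
    by unfold_locales (fact f P Q)+
  have d: "deriv_x A (U, x) i f u = fd F (tx u) (axis i 1, 0)"
    "deriv_xdot A (U, x) i f u = fd F (tx u) (0, axis i 1)" for i u
    by (simp_all add: deriv_x_def deriv_xdot_def tangent_chart_eq chart_deriv_def o_def)
  have dd: "deriv_x A (U, x) i (deriv_x A (U, x) j f) u = fd (\<lambda>z. fd F z (axis j 1, 0)) (tx u) (axis i 1, 0)"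
    "deriv_x A (U, x) i (deriv_xdot A (U, x) j f) u = fd (\<lambda>z. fd F z (0, axis j 1)) (tx u) (axis i 1, 0)"
    "deriv_xdot A (U, x) i (deriv_xdot A (U, x) j f) u = fd (\<lambda>z. fd F z (0, axis j 1)) (tx u) (0, axis i 1)"
    if "u \<in> bundle_over A U" for i j u
    using TM.chart_deriv_chart_deriv[OF that] by (simp_all add: deriv_x_def deriv_xdot_def tangent_chart_eq)
  have base: "ix (fst (tx u)) = fst u" if "u \<in> bundle_over A U" for u
    using that by (rule bundle_point) simp
  \<comment> \<open>\<open>tx\<close> maps the bundle over \<open>U\<close> onto \<open>S\<close>,
    so quantifying over coordinate points is quantifying over tangent vectors.\<close>
  show ?thesis
    unfolding kaehler_iff_equations tx_S[symmetric] ball_simps(9)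
    by (intro ball_cong refl) (simp only: dd d base)
qed

end
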